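(* Let $k$ be an algebraically closed field, $\mathcal Q=k(T)$, $\mathcal Z=k[T]$, and let $K$ be a finite separable extension of $\mathcal Q$ of degree $n$, with $\mathcal O_K$ the integral closure of $\mathcal Z$ in $K$. Suppose that $K/\mathcal Q$ is totally ramified above $\infty$ (the place of $\mathcal Q$ with uniformizer $T^{-1}$) and that the characteristic of $k$ does not divide $n$. Then \[\tfrac12\big(\deg(d_K)-n-1\big)\leq M(K)\leq\deg(d_K)-n.\]
   Context: $d_K$ is the discriminant of $\mathcal O_K$ over $\mathcal Z$, an ideal of $\mathcal Z$ generated by a polynomial $f$, and $\deg(d_K)=\deg(f)$. On $\mathcal Q$, $\deg$ is the degree at infinity: $\deg(a/b)=\deg(a)-\deg(b)$ for polynomials $a,b\neq0$, and $\deg(0)=-\infty$. The Euclidean minimum is \[M(K)=\max_{x\in K}\min_{y\in\mathcal O_K}\deg\big(N_{K/\mathcal Q}(x-y)\big).\] *)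

theory Defs
  imports
    "HOL-Library.Extended_Real"
    "HOL-Computational_Algebra.Computational_Algebra"
    "Jordan_Normal_Form.Determinant"
begin

text \<open>
  A field extension is given by a field homomorphism \<open>\<iota>\<close> from the base field into the
  extension field; the extension is a vector space over the base field via \<open>\<iota>\<close>.
\<close>

definition ext_scale :: "('f::field \<Rightarrow> 'l::field) \<Rightarrow> 'f \<Rightarrow> 'l \<Rightarrow> 'l" where
  "ext_scale \<iota> c x = \<iota> c * x"

definition finite_ext :: "('f::field \<Rightarrow> 'l::field) \<Rightarrow> bool" where
  "finite_ext \<iota> \<longleftrightarrow> (\<exists>B. finite B \<and> module.span (ext_scale \<iota>) B = UNIV)"

definition ext_degree :: "('f::field \<Rightarrow> 'l::field) \<Rightarrow> nat" where
  "ext_degree \<iota> = vector_space.dim (ext_scale \<iota>) UNIV"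

text \<open>
  An irreducible polynomial is coprime to its formal derivative iff it has no repeated root in
  an algebraic closure, so this says that every minimal polynomial is separable.
\<close>

definition separable_ext :: "('f::field \<Rightarrow> 'l::field) \<Rightarrow> bool" where
  "separable_ext \<iota> \<longleftrightarrow>
     (\<forall>x. \<exists>p. irreducible p \<and> poly (map_poly \<iota> p) x = 0 \<and> coprime p (pderiv p))"

definition ext_basis :: "('f::field \<Rightarrow> 'l::field) \<Rightarrow> 'l list \<Rightarrow> bool" where
  "ext_basis \<iota> bs \<longleftrightarrow> distinct bs \<and> \<not> module.dependent (ext_scale \<iota>) (set bs) \<and>
     module.span (ext_scale \<iota>) (set bs) = UNIV"

text \<open>The matrix, with respect to the basis \<open>bs\<close>, of multiplication by \<open>x\<close>.\<close>

definition mult_matrix :: "('f::field \<Rightarrow> 'l::field) \<Rightarrow> 'l list \<Rightarrow> 'l \<Rightarrow> 'f mat" where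
  "mult_matrix \<iota> bs x = mat (length bs) (length bs)
     (\<lambda>(i, j). module.representation (ext_scale \<iota>) (set bs) (x * bs ! j) (bs ! i))"

text \<open>Norm and trace do not depend on the chosen basis.\<close>

definition ext_norm :: "('f::field \<Rightarrow> 'l::field) \<Rightarrow> 'l \<Rightarrow> 'f" where
  "ext_norm \<iota> x = det (mult_matrix \<iota> (SOME bs. ext_basis \<iota> bs) x)"

definition ext_trace :: "('f::field \<Rightarrow> 'l::field) \<Rightarrow> 'l \<Rightarrow> 'f" where
  "ext_trace \<iota> x = (let A = mult_matrix \<iota> (SOME bs. ext_basis \<iota> bs) x
     in \<Sum>i<dim_row A. A $$ (i, i))"

definition disc_list :: "('f::field \<Rightarrow> 'l::field) \<Rightarrow> 'l list \<Rightarrow> 'f" where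
  "disc_list \<iota> xs =
     det (mat (length xs) (length xs) (\<lambda>(i, j). ext_trace \<iota> (xs ! i * xs ! j)))"

text \<open>
  From here on the base field is the field \<open>k(T)\<close> of fractions of the polynomial ring
  \<open>k[T]\<close>, which embeds into it by \<^const>\<open>to_fract\<close>.
\<close>

definition ring_of_integers :: "('k::field poly fract \<Rightarrow> 'l::field) \<Rightarrow> 'l set" where
  "ring_of_integers \<iota> =
     {x. \<exists>p. lead_coeff p = 1 \<and> poly (map_poly (\<lambda>a. \<iota> (to_fract a)) p) x = 0}"

text \<open>
  The ideal of \<open>k[T]\<close> generated by the discriminants of all \<open>n\<close>-tuples of integral elements,
  where \<open>n\<close> is the degree; \<open>module.span (*)\<close> is the ideal generated by a set.  As the ring of
  integers is free of rank \<open>n\<close> over \<open>k[T]\<close> for separable extensions, the discriminant of any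
  integral basis generates this ideal.
\<close>

definition disc_ideal :: "('k::field poly fract \<Rightarrow> 'l::field) \<Rightarrow> 'k poly set" where
  "disc_ideal \<iota> = module.span (*)
     {f. \<exists>xs. length xs = ext_degree \<iota> \<and> set xs \<subseteq> ring_of_integers \<iota> \<and>
              to_fract f = disc_list \<iota> xs}"

text \<open>Generators of an ideal of \<open>k[T]\<close> are associated, hence all of the same degree.\<close>

definition ideal_degree :: "'k::field poly set \<Rightarrow> nat" where
  "ideal_degree I = degree (SOME f. module.span (*) {f} = I)"

text \<open>
  The degree at infinity as an integer (meaningful for nonzero arguments, with value 0 at 0).
  Its negative is the normalised valuation of \<open>k(T)\<close> at infinity.
\<close>

definition int_deg_infty :: "'k::field poly fract \<Rightarrow> int" where
  "int_deg_infty q = (if q = 0 then 0 else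
     THE d. \<exists>a b. a \<noteq> 0 \<and> b \<noteq> 0 \<and> q = Fract a b \<and> d = int (degree a) - int (degree b))"

lemma int_deg_infty_Fract:
  fixes a b :: "'k::field poly"
  assumes "a \<noteq> 0" "b \<noteq> 0"
  shows "int_deg_infty (Fract a b) = int (degree a) - int (degree b)"
proof -
  have nz: "Fract a b \<noteq> 0"
    using assms by (simp add: Zero_fract_def eq_fract)
  have "int (degree c) - int (degree d) = int (degree a) - int (degree b)"
    if "c \<noteq> 0" "d \<noteq> 0" "Fract a b = Fract c d" for c d :: "'k poly"
  proof -
    from that assms have "a * d = c * b" by (simp add: eq_fract)
    hence "degree (a * d) = degree (c * b)" by simp
    with that assms have "degree a + degree d = degree c + degree b"
      by (simp add: degree_mult_eq)
    thus ?thesis by linarith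
  qed
  hence "(THE d. \<exists>p q. p \<noteq> 0 \<and> q \<noteq> 0 \<and> Fract a b = Fract p q \<and>
      d = int (degree p) - int (degree q)) = int (degree a) - int (degree b)"
    using assms by (intro the_equality) blast+
  with nz show ?thesis
    unfolding int_deg_infty_def by (simp only: if_False)
qed

definition deg_infty :: "'k::field poly fract \<Rightarrow> ereal" where
  "deg_infty q = (if q = 0 then -\<infinity> else ereal (of_int (int_deg_infty q)))"

text \<open>
  Normalised discrete valuations (that is, places) of a field.  The value at 0, which should be
  infinite, is fixed to be 0, so that distinct functions are distinct valuations.
\<close>

definition discrete_valuation :: "('l::field \<Rightarrow> int) \<Rightarrow> bool" where
  "discrete_valuation v \<longleftrightarrow> v 0 = 0 \<and>
     (\<forall>x y. x \<noteq> 0 \<longrightarrow> y \<noteq> 0 \<longrightarrow> v (x * y) = v x + v y) \<and>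
     (\<forall>x y. x \<noteq> 0 \<longrightarrow> y \<noteq> 0 \<longrightarrow> x + y \<noteq> 0 \<longrightarrow> min (v x) (v y) \<le> v (x + y)) \<and>
     v ` (- {0}) = UNIV"

text \<open>The place \<open>v\<close> lies above infinity, with ramification index \<open>e\<close>.\<close>

definition above_infinity ::
    "('k::field poly fract \<Rightarrow> 'l::field) \<Rightarrow> ('l \<Rightarrow> int) \<Rightarrow> nat \<Rightarrow> bool" where
  "above_infinity \<iota> v e \<longleftrightarrow> discrete_valuation v \<and> e > 0 \<and>
     (\<forall>q. q \<noteq> 0 \<longrightarrow> v (\<iota> q) = int e * (- int_deg_infty q))"

definition totally_ramified_infinity :: "('k::field poly fract \<Rightarrow> 'l::field) \<Rightarrow> bool" where
  "totally_ramified_infinity \<iota> \<longleftrightarrow>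
     (\<exists>v. above_infinity \<iota> v (ext_degree \<iota>) \<and> (\<forall>w e. above_infinity \<iota> w e \<longrightarrow> w = v))"

definition local_euclidean_min :: "('k::field poly fract \<Rightarrow> 'l::field) \<Rightarrow> 'l \<Rightarrow> ereal" where
  "local_euclidean_min \<iota> x = (INF y\<in>ring_of_integers \<iota>. deg_infty (ext_norm \<iota> (x - y)))"

definition euclidean_min :: "('k::field poly fract \<Rightarrow> 'l::field) \<Rightarrow> ereal" where
  "euclidean_min \<iota> = (SUP x. local_euclidean_min \<iota> x)"

text \<open>The infima and the supremum above are a minimum for each \<open>x\<close> and a maximum.\<close>

definition euclidean_min_attained :: "('k::field poly fract \<Rightarrow> 'l::field) \<Rightarrow> bool" where
  "euclidean_min_attained \<iota> \<longleftrightarrow>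
     (\<forall>x. \<exists>y\<in>ring_of_integers \<iota>. deg_infty (ext_norm \<iota> (x - y)) = local_euclidean_min \<iota> x) \<and>
     (\<exists>x. local_euclidean_min \<iota> x = euclidean_min \<iota>)"

end

theory Submission
  imports Defs "Jordan_Normal_Form.Char_Poly"
begin

text \<open>
  Let \<open>v\<close> be the place above infinity and \<open>dg = - v\<close>.  Total ramification gives bases of
  \<open>K\<close> whose degrees \<open>dg\<close> represent every residue class modulo \<open>n\<close> once, so that no leading
  terms cancel in a linear combination over \<open>k(T)\<close>.  In such a basis one term of the Leibniz
  expansion dominates the determinant of multiplication by \<open>x\<close>, hence the norm of \<open>x\<close> has
  degree \<open>dg x\<close>; also the residue field at infinity is \<open>k\<close>.

  Let \<open>S\<close> be the numerical semigroup of the degrees of nonzero integral elements.  The degree of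
  \<open>x\<close> can be lowered by subtracting an integral element exactly if \<open>dg x \<in> S\<close>, so the Euclidean
  minimum is the largest integer outside \<open>S\<close>.  Integral elements \<open>w i\<close> of minimal degree in
  the residue class of \<open>i\<close> modulo \<open>n\<close> form a basis of the ring of integers over \<open>k[T]\<close>, and
  the Euclidean minimum is \<open>max (dg (w i)) - n\<close>.

  As \<open>n\<close> is invertible in \<open>k\<close>, the trace of \<open>x\<close> has degree \<open>dg x / n\<close> if \<open>n\<close> divides
  \<open>dg x\<close> and smaller degree otherwise.  So the trace matrix of \<open>w\<close> again has a dominant
  Leibniz term, and the discriminant has degree \<open>2 / n * (\<Sum>i<n. dg (w i))\<close>.
\<close>

subsection \<open>Norm and trace in an arbitrary basis\<close>

lemma trace_mult_commute:
  fixes A B :: "'a::comm_ring_1 mat"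
  assumes "A \<in> carrier_mat m m" "B \<in> carrier_mat m m"
  shows "(\<Sum>i<m. (A * B) $$ (i, i)) = (\<Sum>i<m. (B * A) $$ (i, i))"
proof -
  have "(\<Sum>i<m. (A * B) $$ (i, i)) = (\<Sum>i<m. \<Sum>k<m. A $$ (i, k) * B $$ (k, i))"
    using assms by (simp add: scalar_prod_def atLeast0LessThan)
  also have "\<dots> = (\<Sum>k<m. \<Sum>i<m. B $$ (k, i) * A $$ (i, k))"
    by (subst sum.swap) (simp add: mult.commute)
  also have "\<dots> = (\<Sum>i<m. (B * A) $$ (i, i))"
    using assms by (simp add: scalar_prod_def atLeast0LessThan)
  finally show ?thesis .
qed

locale finite_extension = field_hom \<iota> for \<iota> :: "'f::field \<Rightarrow> 'l::field" +
  assumes finite: "finite_ext \<iota>"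
begin

sublocale vs: vector_space "ext_scale \<iota>"
  by unfold_locales (auto simp: ext_scale_def hom_distribs algebra_simps)

section \<open>Indexed bases and their coordinates\<close>

abbreviation (input) n where "n \<equiv> ext_degree \<iota>"

text \<open>Indexing by natural numbers instead of a list lets positions double as residues modulo
  \<open>n\<close> later. Values of \<open>b\<close> from \<open>n\<close> on are
  irrelevant.\<close>

definition basis :: "(nat \<Rightarrow> 'l) \<Rightarrow> bool" where
  "basis b \<longleftrightarrow> ext_basis \<iota> (map b [0..<n])"

definition coord :: "(nat \<Rightarrow> 'l) \<Rightarrow> 'l \<Rightarrow> nat \<Rightarrow> 'f" where
  "coord b x i = vs.representation (b ` {..<n}) x (b i)"

lemma basis_iff:
  "basis b \<longleftrightarrow> inj_on b {..<n} \<and> vs.independent (b ` {..<n}) \<and> vs.span (b ` {..<n}) = UNIV"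
  by (simp add: basis_def ext_basis_def distinct_map atLeast0LessThan)

lemma ext_basis_length:
  assumes "ext_basis \<iota> bs"
  shows "length bs = n"
proof -
  have "length bs = card (set bs)"
    using assms by (simp add: ext_basis_def distinct_card)
  also have "\<dots> = n"
    unfolding ext_degree_def
    using assms by (intro vs.basis_card_eq_dim) (auto simp: ext_basis_def)
  finally show ?thesis .
qed

lemma ex_ext_basis: "\<exists>bs. ext_basis \<iota> bs"
proof -
  obtain S where S: "finite S" "vs.span S = UNIV"
    using finite by (auto simp: finite_ext_def)
  obtain B where B: "B \<subseteq> S" "vs.independent B" "S \<subseteq> vs.span B"
    using vs.maximal_independent_subset by blast
  have "vs.span B = UNIV"
    using S B by (metis top.extremum_uniqueI vs.span_minimal vs.subspace_span)
  moreover obtain bs where "set bs = B" "distinct bs"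
    using finite_distinct_list[of B] finite_subset[OF B(1) S(1)] by blast
  ultimately show ?thesis
    using B by (auto simp: ext_basis_def)
qed

lemma basis_expand:
  assumes "basis b"
  shows "(\<Sum>i<n. \<iota> (coord b x i) * b i) = x"
proof -
  have "(\<Sum>v\<in>b ` {..<n}. ext_scale \<iota> (vs.representation (b ` {..<n}) x v) v) = x"
    using assms by (intro vs.sum_representation_eq) (auto simp: basis_iff)
  then show ?thesis
    using assms by (simp add: basis_iff sum.reindex ext_scale_def coord_def)
qed

lemma coord_unique:
  assumes "basis b" "x = (\<Sum>i<n. \<iota> (c i) * b i)" "i < n"
  shows "coord b x i = c i"
proof -
  have inj: "inj_on b {..<n}" and ind: "vs.independent (b ` {..<n})"
    and sp: "vs.span (b ` {..<n}) = UNIV"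
    using assms(1) by (auto simp: basis_iff)
  have "0 = (\<Sum>i<n. \<iota> (coord b x i) * b i) - (\<Sum>i<n. \<iota> (c i) * b i)"
    using basis_expand[OF assms(1), of x] assms(2) by simp
  also have "\<dots> = (\<Sum>i<n. ext_scale \<iota> (coord b x i - c i) (b i))"
    by (simp add: ext_scale_def hom_distribs sum_subtractf algebra_simps)
  also have "\<dots> = (\<Sum>v\<in>b ` {..<n}. ext_scale \<iota> ((\<lambda>i. coord b x i - c i) (the_inv_into {..<n} b v)) v)"
    using inj by (simp add: sum.reindex the_inv_into_f_f)
  finally have "(\<lambda>i. coord b x i - c i) (the_inv_into {..<n} b (b i)) = 0"
    using assms(3) by (intro vs.independentD[OF ind]) auto
  then show ?thesis
    using inj assms(3) by (simp add: the_inv_into_f_f)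
qed

text \<open>A dimension count: if the family failed to span, it could be enlarged to
  \<open>n + 1\<close> independent elements. A repetition \<open>b i = b j\<close> is excluded by
  the relation \<open>b i - b j = 0\<close>.\<close>

lemma basisI:
  assumes "\<And>c i. (\<Sum>i<n. \<iota> (c i) * b i) = 0 \<Longrightarrow> i < n \<Longrightarrow> c i = 0"
  shows "basis b"
proof -
  have inj: "inj_on b {..<n}"
  proof (rule inj_onI, rule ccontr)
    fix i j assume ij: "i \<in> {..<n}" "j \<in> {..<n}" "b i = b j" "i \<noteq> j"
    define c :: "nat \<Rightarrow> 'f" where "c = (\<lambda>k. if k = i then 1 else if k = j then - 1 else 0)"
    have "(\<Sum>k<n. \<iota> (c k) * b k) = (\<Sum>k\<in>{i, j}. \<iota> (c k) * b k)"
      using ij by (intro sum.mono_neutral_right) (auto simp: c_def)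
    also have "\<dots> = 0"
      using ij by (simp add: c_def hom_distribs)
    finally have "c i = 0"
      using assms[of c i] ij by simp
    then show False
      by (simp add: c_def)
  qed
  have ind: "vs.independent (b ` {..<n})"
  proof
    assume "vs.dependent (b ` {..<n})"
    then obtain u v where v: "v \<in> b ` {..<n}" "u v \<noteq> 0"
      and "(\<Sum>v\<in>b ` {..<n}. ext_scale \<iota> (u v) v) = 0"
      by (auto simp: vs.dependent_finite)
    then have "(\<Sum>i<n. \<iota> (u (b i)) * b i) = 0"
      using inj by (simp add: sum.reindex ext_scale_def)
    then have "i < n \<Longrightarrow> u (b i) = 0" for i
      by (rule assms)
    then show False
      using v by auto
  qed
  have "vs.span (b ` {..<n}) = UNIV"
  proof (rule ccontr)
    assume "vs.span (b ` {..<n}) \<noteq> UNIV"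
    then obtain a where a: "a \<notin> vs.span (b ` {..<n})"
      by blast
    have "card (insert a (b ` {..<n})) = Suc n"
      using a inj by (subst card_insert_disjoint) (auto simp: card_image intro: vs.span_base)
    moreover have "vs.independent (insert a (b ` {..<n}))"
      using a ind by (rule vs.independent_insertI)
    moreover obtain bs where bs: "ext_basis \<iota> bs"
      using ex_ext_basis by blast
    ultimately have "Suc n \<le> card (set bs)"
      using vs.independent_span_bound[of "set bs" "insert a (b ` {..<n})"]
      by (auto simp: ext_basis_def)
    also have "\<dots> \<le> n"
      using ext_basis_length[OF bs] card_length[of bs] by simp
    finally show False
      by simp
  qed
  with inj ind show ?thesis
    by (simp add: basis_iff)
qed

lemma coord_add: "basis b \<Longrightarrow> coord b (x + y) i = coord b x i + coord b y i"
  by (simp add: basis_iff coord_def vs.representation_add)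

lemma coord_scale: "basis b \<Longrightarrow> coord b (\<iota> c * x) i = c * coord b x i"
  using vs.representation_scale[of "b ` {..<n}" x c] by (simp add: basis_iff coord_def ext_scale_def)

section \<open>Basis independence of norm and trace\<close>

definition mult_mat :: "(nat \<Rightarrow> 'l) \<Rightarrow> 'l \<Rightarrow> 'f mat" where
  "mult_mat b x = mat n n (\<lambda>(i, j). coord b (x * b j) i)"

lemma mult_mat_carrier [simp]: "mult_mat b x \<in> carrier_mat n n"
  by (simp add: mult_mat_def)

lemma coord_basis_self:
  assumes "basis b" "i < n" "j < n"
  shows "coord b (b j) i = (if i = j then 1 else 0)"
proof (rule coord_unique[OF assms(1) _ assms(2)])
  have "(\<Sum>i<n. \<iota> (if i = j then 1 else 0) * b i) = (\<Sum>i<n. if i = j then b j else 0)"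
    by (intro sum.cong) auto
  then show "b j = (\<Sum>i<n. \<iota> (if i = j then 1 else 0) * b i)"
    using assms by simp
qed

text \<open>These sums are the entries of the product of the two change-of-basis matrices, which are
  therefore mutually inverse.\<close>

lemma basis_coord_basis:
  assumes "basis b" "basis c" "i < n" "j < n"
  shows "(\<Sum>k<n. coord b (c k) i * coord c (b j) k) = (if i = j then 1 else 0)"
proof -
  have "coord b (b j) i = (\<Sum>k<n. coord b (c k) i * coord c (b j) k)"
  proof (rule coord_unique[OF assms(1) _ assms(3)])
    have "(\<Sum>i<n. \<iota> (\<Sum>k<n. coord b (c k) i * coord c (b j) k) * b i)
        = (\<Sum>i<n. \<Sum>k<n. \<iota> (coord c (b j) k) * (\<iota> (coord b (c k) i) * b i))"
      by (simp add: hom_distribs sum_distrib_right mult_ac)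
    also have "\<dots> = (\<Sum>k<n. \<iota> (coord c (b j) k) * (\<Sum>i<n. \<iota> (coord b (c k) i) * b i))"
      by (subst sum.swap) (simp add: sum_distrib_left)
    also have "\<dots> = b j"
      by (simp add: basis_expand assms)
    finally show "b j = (\<Sum>i<n. \<iota> (\<Sum>k<n. coord b (c k) i * coord c (b j) k) * b i)" ..
  qed
  then show ?thesis
    by (simp add: coord_basis_self assms)
qed

lemma similar_mult_mat:
  assumes "basis b" "basis c"
  shows "similar_mat (mult_mat b x) (mult_mat c x)"
proof -
  define P where "P = mat n n (\<lambda>(i, j). coord b (c j) i)"
  define Q where "Q = mat n n (\<lambda>(i, j). coord c (b j) i)"
  have [simp]: "P \<in> carrier_mat n n" "Q \<in> carrier_mat n n"
    by (auto simp: P_def Q_def)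
  have PQ: "P * Q = 1\<^sub>m n"
    using basis_coord_basis[OF assms]
    by (intro eq_matI) (auto simp: P_def Q_def scalar_prod_def atLeast0LessThan)
  have QP: "Q * P = 1\<^sub>m n"
    using basis_coord_basis[OF assms(2,1)]
    by (intro eq_matI) (auto simp: P_def Q_def scalar_prod_def atLeast0LessThan)
  have eq: "mult_mat b x = P * mult_mat c x * Q"
  proof (rule eq_matI)
    fix i j assume "i < dim_row (P * mult_mat c x * Q)" "j < dim_col (P * mult_mat c x * Q)"
    then have ij: "i < n" "j < n"
      by (simp_all add: P_def Q_def)
    define M where "M = (\<lambda>m l. coord c (x * c l) m)"
    have "coord b (x * b j) i = (\<Sum>l<n. (\<Sum>m<n. coord b (c m) i * M m l) * coord c (b j) l)"
    proof (rule coord_unique[OF assms(1) _ ij(1)])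
      have "(\<Sum>i<n. \<iota> (\<Sum>l<n. (\<Sum>m<n. coord b (c m) i * M m l) * coord c (b j) l) * b i)
         = (\<Sum>i<n. \<Sum>l<n. \<Sum>m<n. \<iota> (coord c (b j) l) * (\<iota> (M m l) * (\<iota> (coord b (c m) i) * b i)))"
        by (simp add: hom_distribs sum_distrib_right sum_distrib_left mult_ac)
      also have "\<dots> = (\<Sum>l<n. \<Sum>i<n. \<Sum>m<n. \<iota> (coord c (b j) l) * (\<iota> (M m l) * (\<iota> (coord b (c m) i) * b i)))"
        by (rule sum.swap)
      also have "\<dots> = (\<Sum>l<n. \<Sum>m<n. \<Sum>i<n. \<iota> (coord c (b j) l) * (\<iota> (M m l) * (\<iota> (coord b (c m) i) * b i)))"
        by (rule sum.cong[OF refl], rule sum.swap)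
      also have "\<dots> = (\<Sum>l<n. \<Sum>m<n. \<iota> (coord c (b j) l) * (\<iota> (M m l) * (\<Sum>i<n. \<iota> (coord b (c m) i) * b i)))"
        by (simp add: sum_distrib_left)
      also have "\<dots> = (\<Sum>l<n. \<iota> (coord c (b j) l) * (\<Sum>m<n. \<iota> (M m l) * c m))"
        by (simp add: basis_expand assms sum_distrib_left)
      also have "\<dots> = x * (\<Sum>l<n. \<iota> (coord c (b j) l) * c l)"
        by (simp only: M_def basis_expand[OF assms(2), of "x * c l" for l] sum_distrib_left
            mult.left_commute[of x])
      also have "\<dots> = x * b j"
        by (simp only: basis_expand[OF assms(2)])
      finally show "x * b j = (\<Sum>i<n. \<iota> (\<Sum>l<n. (\<Sum>m<n. coord b (c m) i * M m l) * coord c (b j) l) * b i)" ..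
    qed
    then show "mult_mat b x $$ (i, j) = (P * mult_mat c x * Q) $$ (i, j)"
      using ij by (simp add: mult_mat_def P_def Q_def M_def scalar_prod_def atLeast0LessThan)
  qed (auto simp: mult_mat_def P_def Q_def)
  show ?thesis
    by (rule similar_matI[OF _ PQ QP eq]) simp
qed

text \<open>Bridges the list picked by \<open>SOME\<close> in the definitions of norm and trace to
  indexed bases. It also serves below as a source of some basis.\<close>

lemma mult_matrix_SOME:
  obtains c where "basis c" "mult_matrix \<iota> (SOME bs. ext_basis \<iota> bs) x = mult_mat c x"
proof -
  define bs where "bs = (SOME bs. ext_basis \<iota> bs)"
  have bs: "ext_basis \<iota> bs"
    unfolding bs_def using ex_ext_basis by (rule someI_ex)
  then have len: "length bs = n"
    by (rule ext_basis_length)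
  then have bs_eq: "map (nth bs) [0..<n] = bs"
    by (metis map_nth)
  have "basis (nth bs)"
    using bs by (simp add: basis_def bs_eq)
  moreover have "set bs = nth bs ` {..<n}"
    using len by (metis atLeast0LessThan bs_eq set_map set_upt)
  then have "mult_matrix \<iota> bs x = mult_mat (nth bs) x"
    by (intro eq_matI) (simp_all add: mult_matrix_def mult_mat_def coord_def len)
  ultimately show ?thesis
    using that by (simp add: bs_def)
qed

lemma ext_norm_eq:
  assumes "basis b"
  shows "ext_norm \<iota> x = det (mult_mat b x)"
proof -
  obtain c where "basis c" and c: "mult_matrix \<iota> (SOME bs. ext_basis \<iota> bs) x = mult_mat c x"
    by (rule mult_matrix_SOME)
  then show ?thesis
    using det_similar[OF similar_mult_mat[OF _ assms, of c x]] by (simp add: ext_norm_def)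
qed

lemma ext_trace_eq:
  assumes "basis b"
  shows "ext_trace \<iota> x = (\<Sum>i<n. coord b (x * b i) i)"
proof -
  obtain c where bc: "basis c" and c: "mult_matrix \<iota> (SOME bs. ext_basis \<iota> bs) x = mult_mat c x"
    by (rule mult_matrix_SOME)
  let ?A = "mult_mat c x" and ?B = "mult_mat b x"
  obtain P Q where PQ: "P \<in> carrier_mat n n" "Q \<in> carrier_mat n n" "Q * P = 1\<^sub>m n" "?A = P * ?B * Q"
    using similar_mult_mat[OF bc assms, of x]
    by (auto simp: similar_mat_def similar_mat_wit_def Let_def mult_mat_def)
  have "ext_trace \<iota> x = (\<Sum>i<n. ?A $$ (i, i))"
    by (simp add: ext_trace_def c Let_def mult_mat_def)
  also have "\<dots> = (\<Sum>i<n. (Q * (P * ?B)) $$ (i, i))"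
    unfolding PQ(4) using PQ(2) mult_carrier_mat[OF PQ(1), of ?B n]
    by (intro trace_mult_commute) auto
  also have "Q * (P * ?B) = (Q * P) * ?B"
    by (rule assoc_mult_mat[OF PQ(2,1) mult_mat_carrier, symmetric])
  also have "\<dots> = ?B"
    unfolding PQ(3) by (rule left_mult_one_mat[OF mult_mat_carrier])
  finally show ?thesis
    by (simp add: mult_mat_def)
qed

lemma ext_trace_add: "ext_trace \<iota> (x + y) = ext_trace \<iota> x + ext_trace \<iota> y"
  and ext_trace_scale: "ext_trace \<iota> (\<iota> c * x) = c * ext_trace \<iota> x"
proof -
  obtain b where b: "basis b"
    by (rule mult_matrix_SOME)
  show "ext_trace \<iota> (x + y) = ext_trace \<iota> x + ext_trace \<iota> y"
    using b by (simp add: ext_trace_eq coord_add distrib_right sum.distrib)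
  show "ext_trace \<iota> (\<iota> c * x) = c * ext_trace \<iota> x"
    using b by (simp add: ext_trace_eq coord_scale mult.assoc sum_distrib_left)
qed

lemma ext_trace_sum: "ext_trace \<iota> (sum f A) = (\<Sum>a\<in>A. ext_trace \<iota> (f a))"
proof (induction A rule: infinite_finite_induct)
  case empty
  then show ?case
    using ext_trace_scale[of 0 0] by simp
next
  case (infinite A)
  then show ?case
    using ext_trace_scale[of 0 0] by simp
qed (simp add: ext_trace_add)

lemma ext_trace_base: "ext_trace \<iota> (\<iota> c) = of_nat n * c"
proof -
  obtain b where b: "basis b"
    by (rule mult_matrix_SOME)
  have "coord b (b i) i = 1" if "i < n" for i
    by (rule coord_basis_self[OF b that that, simplified])
  then show ?thesis
    using b by (simp add: ext_trace_eq coord_scale)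
qed

end

subsection \<open>Degrees at a totally ramified place\<close>

locale degree_valuation =
  fixes v :: "'l::field \<Rightarrow> int"
  assumes discrete: "discrete_valuation v"
begin

section \<open>The degree as negative valuation; dominant terms\<close>

definition dg :: "'l \<Rightarrow> int" where
  "dg x = - v x"

text \<open>\<open>dg 0 = 0\<close> is a junk value; \<open>bd\<close> treats the degree of 0 as \<open>- \<infinity>\<close>.\<close>

definition bd :: "int \<Rightarrow> 'l \<Rightarrow> bool" where
  "bd m x \<longleftrightarrow> x = 0 \<or> dg x \<le> m"

lemma dg_mult: "x \<noteq> 0 \<Longrightarrow> y \<noteq> 0 \<Longrightarrow> dg (x * y) = dg x + dg y"
  using discrete by (auto simp: discrete_valuation_def dg_def)

lemma dg_0 [simp]: "dg 0 = 0"
  using discrete by (simp add: discrete_valuation_def dg_def)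

lemma dg_1 [simp]: "dg 1 = 0"
  using dg_mult[of 1 1] by simp

lemma dg_uminus [simp]: "dg (- x) = dg x"
proof (cases "x = 0")
  case False
  have "dg (- 1) + dg (- 1) = 0"
    using dg_mult[of "- 1" "- 1"] by simp
  then show ?thesis
    using dg_mult[of "- 1" x] False by simp
qed simp

lemma dg_power: "x \<noteq> 0 \<Longrightarrow> dg (x ^ k) = int k * dg x"
  by (induction k) (auto simp: dg_mult algebra_simps)

lemma dg_prod: "(\<And>i. i \<in> A \<Longrightarrow> f i \<noteq> 0) \<Longrightarrow> dg (prod f A) = (\<Sum>i\<in>A. dg (f i))"
  by (induction A rule: infinite_finite_induct) (auto simp: dg_mult)

lemma ex_dg: "\<exists>x. x \<noteq> 0 \<and> dg x = m"
proof -
  have "- m \<in> v ` (- {0})"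
    using discrete by (simp add: discrete_valuation_def)
  then show ?thesis
    by (auto simp: dg_def)
qed

lemma bd_0 [simp]: "bd m 0"
  by (simp add: bd_def)

lemma bd_dg: "bd (dg x) x"
  by (simp add: bd_def)

lemma bd_mono: "bd m x \<Longrightarrow> m \<le> m' \<Longrightarrow> bd m' x"
  by (auto simp: bd_def)

lemma bd_uminus [simp]: "bd m (- x) = bd m x"
  by (simp add: bd_def)

lemma bd_add:
  assumes "bd m x" "bd m y"
  shows "bd m (x + y)"
proof (cases "x = 0 \<or> y = 0 \<or> x + y = 0")
  case False
  then have "min (v x) (v y) \<le> v (x + y)"
    using discrete by (simp add: discrete_valuation_def)
  then show ?thesis
    using assms False by (auto simp: bd_def dg_def)
qed (use assms in auto)

lemma bd_diff: "bd m x \<Longrightarrow> bd m y \<Longrightarrow> bd m (x - y)"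
  using bd_add[of m x "- y"] by simp

lemma bd_sum: "(\<And>i. i \<in> A \<Longrightarrow> bd m (f i)) \<Longrightarrow> bd m (sum f A)"
  by (induction A rule: infinite_finite_induct) (auto intro: bd_add)

lemma bd_mult: "bd m x \<Longrightarrow> bd m' y \<Longrightarrow> bd (m + m') (x * y)"
  by (cases "x = 0 \<or> y = 0") (auto simp: bd_def dg_mult)

lemma bd_prod: "(\<And>i. i \<in> A \<Longrightarrow> bd (m i) (f i)) \<Longrightarrow> bd (sum m A) (prod f A)"
proof (induction A rule: infinite_finite_induct)
  case (insert x F)
  then show ?case
    by (auto intro: bd_mult)
qed (auto simp: bd_def)

text \<open>If the degree of \<open>x + y\<close> dropped, \<open>x\<close> would be the difference
  of two elements that vanish or have degree below \<open>dg x\<close>.\<close>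

lemma dg_add_eq:
  assumes "x \<noteq> 0" "bd (dg x - 1) y"
  shows "x + y \<noteq> 0" "dg (x + y) = dg x"
proof -
  have *: "\<not> bd (dg x - 1) (x + y)"
  proof
    assume "bd (dg x - 1) (x + y)"
    from bd_diff[OF this assms(2)] show False
      using assms(1) by (simp add: bd_def)
  qed
  then show "x + y \<noteq> 0"
    by auto
  have "bd (dg x) (x + y)"
    using assms by (intro bd_add bd_dg) (auto intro: bd_mono)
  then show "dg (x + y) = dg x"
    using * by (auto simp: bd_def)
qed

lemma dg_sum_dominant:
  assumes "finite A" "i \<in> A" "f i \<noteq> 0" "\<And>j. j \<in> A - {i} \<Longrightarrow> bd (dg (f i) - 1) (f j)"
  shows "sum f A \<noteq> 0" "dg (sum f A) = dg (f i)"
proof -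
  have "sum f A = f i + sum f (A - {i})"
    using assms by (simp add: sum.remove)
  moreover have "bd (dg (f i) - 1) (sum f (A - {i}))"
    using assms(4) by (rule bd_sum)
  ultimately show "sum f A \<noteq> 0" "dg (sum f A) = dg (f i)"
    using dg_add_eq[of "f i" "sum f (A - {i})"] assms(3) by simp_all
qed

lemma bd_signof_mult [simp]: "bd m (signof p * x) = bd m x"
  by (simp add: sign_def)

text \<open>In the Leibniz expansion the term of \<open>\<pi>\<close> strictly dominates all others.\<close>

lemma dg_det:
  assumes A: "A \<in> carrier_mat N N" and \<pi>: "\<pi> permutes {0..<N}"
    and nz: "\<And>i. i < N \<Longrightarrow> A $$ (i, \<pi> i) \<noteq> 0"
    and eq: "\<And>i. i < N \<Longrightarrow> dg (A $$ (i, \<pi> i)) = r i + c (\<pi> i)"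
    and less: "\<And>i j. i < N \<Longrightarrow> j < N \<Longrightarrow> j \<noteq> \<pi> i \<Longrightarrow> bd (r i + c j - 1) (A $$ (i, j))"
  shows "det A \<noteq> 0" "dg (det A) = (\<Sum>i<N. r i) + (\<Sum>i<N. c i)"
proof -
  define S where "S = (\<Sum>i<N. r i) + (\<Sum>i<N. c i)"
  define T where "T = (\<lambda>p. signof p * (\<Prod>i = 0..<N. A $$ (i, p i)))"
  \<comment> \<open>Each row and each column is used once, so the degree bound \<open>S\<close> on a
    Leibniz term does not depend on the permutation.\<close>
  have S: "(\<Sum>i = 0..<N. r i + c (p i)) = S" if "p permutes {0..<N}" for p
    using sum.permute[OF that, of c] by (simp add: S_def sum.distrib comp_def atLeast0LessThan)
  have bd_entry: "bd (r i + c j) (A $$ (i, j))" if "i < N" "j < N" for i j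
    using eq[of i] less[of i j] that by (cases "j = \<pi> i") (auto simp: bd_def)
  have T\<pi>: "T \<pi> \<noteq> 0" "dg (T \<pi>) = S"
  proof -
    have "dg (\<Prod>i = 0..<N. A $$ (i, \<pi> i)) = S"
      using nz eq S[OF \<pi>] by (subst dg_prod) auto
    then show "T \<pi> \<noteq> 0" "dg (T \<pi>) = S"
      using nz by (auto simp: T_def sign_def)
  qed
  have "bd (dg (T \<pi>) - 1) (T p)" if p: "p \<in> {p. p permutes {0..<N}} - {\<pi>}" for p
  proof -
    from p have pp: "p permutes {0..<N}" and "p \<noteq> \<pi>"
      by auto
    then obtain k where "p k \<noteq> \<pi> k"
      by auto
    then have k: "k < N" "p k \<noteq> \<pi> k"
      using pp \<pi> by (auto simp: permutes_def) (metis atLeastLessThan_iff le0)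
    have lt: "p i < N" if "i < N" for i
      using permutes_in_image[OF pp, of i] that by simp
    \<comment> \<open>In row \<open>k\<close> the permutation \<open>p\<close> departs from
      \<open>\<pi>\<close>, which saves one unit of degree; a single such row suffices.\<close>
    define m where "m = (\<lambda>i. r i + c (p i) - (if i = k then 1 else 0))"
    have "bd (sum m {0..<N}) (\<Prod>i = 0..<N. A $$ (i, p i))"
      using less[OF k(1) lt[OF k(1)] k(2)] bd_entry lt
      by (intro bd_prod) (auto simp: m_def)
    moreover have "sum m {0..<N} = S - 1"
      using k(1) S[OF pp] by (simp add: m_def sum_subtractf)
    ultimately show ?thesis
      using T\<pi> by (simp add: T_def)
  qed
  then have "sum T {p. p permutes {0..<N}} \<noteq> 0" "dg (sum T {p. p permutes {0..<N}}) = dg (T \<pi>)"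
    using dg_sum_dominant[of "{p. p permutes {0..<N}}" \<pi> T] \<pi> T\<pi>(1)
    by (simp_all add: finite_permutations)
  then show "det A \<noteq> 0" "dg (det A) = (\<Sum>i<N. r i) + (\<Sum>i<N. c i)"
    using T\<pi> by (simp_all add: det_def'[OF A] T_def S_def)
qed

end

section \<open>The copy of k[T] inside the extension field\<close>

locale function_field_extension = field_hom \<iota>
  for \<iota> :: "'k::field poly fract \<Rightarrow> 'l::field"
begin

definition h :: "'k poly \<Rightarrow> 'l" where
  "h p = \<iota> (to_fract p)"

sublocale h: inj_comm_ring_hom h
  by unfold_locales (auto simp: h_def hom_distribs)

sublocale hm: Modules.module "\<lambda>p u. h p * u"
  by unfold_locales (simp_all add: algebra_simps h.hom_add h.hom_mult)

end

locale totally_ramified = finite_extension \<iota> + function_field_extension \<iota>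
  for \<iota> :: "'k::field poly fract \<Rightarrow> 'l::field" +
  fixes v :: "'l \<Rightarrow> int"
  assumes above: "above_infinity \<iota> v (ext_degree \<iota>)"
begin

sublocale degree_valuation v
  using above by unfold_locales (simp add: above_infinity_def)

lemma n_pos: "n > 0"
  using above by (simp add: above_infinity_def)

lemma dg_base: "q \<noteq> 0 \<Longrightarrow> dg (\<iota> q) = int n * int_deg_infty q"
  using above by (simp add: above_infinity_def dg_def)

lemma int_deg_to_fract: "p \<noteq> 0 \<Longrightarrow> int_deg_infty (to_fract p) = int (degree p)"
  using int_deg_infty_Fract[of p 1] by (simp add: to_fract_def)

lemma dg_h: "p \<noteq> 0 \<Longrightarrow> dg (h p) = int n * int (degree p)"
  by (simp add: h_def dg_base int_deg_to_fract)

section \<open>Bases graded by the degree modulo \<open>n\<close>\<close>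

lemma dg_base_mult_mod:
  assumes "q \<noteq> 0" "x \<noteq> 0"
  shows "dg (\<iota> q * x) mod int n = dg x mod int n"
  using assms by (simp add: dg_mult dg_base)

definition graded :: "(nat \<Rightarrow> 'l) \<Rightarrow> bool" where
  "graded b \<longleftrightarrow> (\<forall>i<n. b i \<noteq> 0 \<and> dg (b i) mod int n = int i)"

lemma gradedD: "graded b \<Longrightarrow> i < n \<Longrightarrow> b i \<noteq> 0" "graded b \<Longrightarrow> i < n \<Longrightarrow> dg (b i) mod int n = int i"
  by (auto simp: graded_def)

lemma graded_term_mod:
  assumes "graded b" "i < n" "q \<noteq> 0"
  shows "\<iota> q * b i \<noteq> 0" "dg (\<iota> q * b i) mod int n = int i"
  using assms by (auto simp: gradedD dg_base_mult_mod)

text \<open>Multiplying by an element of k(T) shifts the degree by a multiple of \<open>n\<close>,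
  so nonzero terms have pairwise distinct degrees and the largest one cannot cancel.\<close>

lemma graded_sum:
  assumes b: "graded b" and x: "x = (\<Sum>i<n. \<iota> (c i) * b i)" and i: "i < n" "c i \<noteq> 0"
  shows "x \<noteq> 0"
    and "\<exists>j<n. c j \<noteq> 0 \<and> dg (\<iota> (c j) * b j) = dg x \<and> (\<forall>k<n. k \<noteq> j \<longrightarrow> bd (dg x - 1) (\<iota> (c k) * b k))"
proof -
  define T where "T = (\<lambda>i. \<iota> (c i) * b i)"
  define J where "J = {i. i < n \<and> c i \<noteq> 0}"
  have "finite J" "J \<noteq> {}"
    using i by (auto simp: J_def)
  then obtain j where j: "j \<in> J" "\<And>k. k \<in> J \<Longrightarrow> dg (T k) \<le> dg (T j)"
    using Max_in[of "(dg \<circ> T) ` J"] Max_ge[of "(dg \<circ> T) ` J"] by fastforce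
  have T: "T k \<noteq> 0" "dg (T k) mod int n = int k" if "k \<in> J" for k
    using graded_term_mod[OF b, of k "c k"] that by (auto simp: T_def J_def)
  have dom: "bd (dg (T j) - 1) (T k)" if k: "k < n" "k \<noteq> j" for k
  proof (cases "c k = 0")
    case False
    then have kJ: "k \<in> J"
      using k by (simp add: J_def)
    have "dg (T k) \<noteq> dg (T j)"
      using T(2)[OF kJ] T(2)[OF j(1)] k by auto
    then show ?thesis
      using j(2)[OF kJ] by (simp add: bd_def)
  qed (simp add: T_def)
  have "x = sum T {..<n}"
    by (simp add: x T_def)
  moreover have "sum T {..<n} \<noteq> 0" "dg (sum T {..<n}) = dg (T j)"
    using dg_sum_dominant[of "{..<n}" j T] T(1)[OF j(1)] j(1) dom by (simp_all add: J_def)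
  ultimately show "x \<noteq> 0"
    and "\<exists>j<n. c j \<noteq> 0 \<and> dg (\<iota> (c j) * b j) = dg x \<and> (\<forall>k<n. k \<noteq> j \<longrightarrow> bd (dg x - 1) (\<iota> (c k) * b k))"
    using j(1) dom by (auto simp: J_def T_def intro!: exI[of _ j])
qed

lemma graded_basis: "graded b \<Longrightarrow> basis b"
  using graded_sum(1) by (intro basisI) blast

text \<open>The valuation is surjective, so all degrees occur. Taking \<open>b 0 = 1\<close> makes
  the coordinate at 0 the component in k(T), which the arguments on traces and on the residue field
  isolate.\<close>

lemma ex_graded: "\<exists>b. graded b \<and> b 0 = 1 \<and> (\<forall>i<n. dg (b i) = int i)"
proof -
  obtain f where f: "f m \<noteq> 0" "dg (f m) = m" for m
    using ex_dg by metis
  then show ?thesis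
    by (intro exI[of _ "(f \<circ> int)(0 := 1)"]) (auto simp: graded_def)
qed

text \<open>The dominant index found in \<open>graded_sum\<close> must be the residue of
  \<open>dg x\<close>, because the dominant term has the degree of \<open>x\<close>.\<close>

lemma graded_coord:
  assumes b: "graded b" and i: "i < n" and x: "x \<noteq> 0"
  shows "dg x mod int n = int i \<Longrightarrow> coord b x i \<noteq> 0 \<and> dg (\<iota> (coord b x i) * b i) = dg x"
    and "dg x mod int n \<noteq> int i \<Longrightarrow> bd (dg x - 1) (\<iota> (coord b x i) * b i)"
proof -
  have sum: "x = (\<Sum>i<n. \<iota> (coord b x i) * b i)"
    using basis_expand[OF graded_basis[OF b]] by simp
  obtain j where "j < n" "coord b x j \<noteq> 0"
    using x sum by (metis (no_types, lifting) hom_zero lessThan_iff mult_zero_left sum.not_neutral_contains_not_neutral)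
  from graded_sum(2)[OF b sum this] obtain j where j: "j < n" "coord b x j \<noteq> 0"
    "dg (\<iota> (coord b x j) * b j) = dg x" "\<And>k. k < n \<Longrightarrow> k \<noteq> j \<Longrightarrow> bd (dg x - 1) (\<iota> (coord b x k) * b k)"
    by blast
  have "dg x mod int n = int j"
    using graded_term_mod(2)[OF b j(1,2)] j(3) by simp
  then show "dg x mod int n = int i \<Longrightarrow> coord b x i \<noteq> 0 \<and> dg (\<iota> (coord b x i) * b i) = dg x"
    and "dg x mod int n \<noteq> int i \<Longrightarrow> bd (dg x - 1) (\<iota> (coord b x i) * b i)"
    using j i by auto
qed

lemma nat_mod_n: "int (nat (m mod int n)) = m mod int n" "nat (m mod int n) < n"
  using n_pos by (auto simp: nat_less_iff)

section \<open>Degrees of norms and traces\<close>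

lemma ext_norm_dg:
  assumes x: "x \<noteq> 0"
  shows "ext_norm \<iota> x \<noteq> 0" "int_deg_infty (ext_norm \<iota> x) = dg x"
proof -
  obtain b where b: "graded b"
    using ex_graded by blast
  note bs = graded_basis[OF b]
  define A where "A = map_mat \<iota> (mult_mat b x)"
  \<comment> \<open>The entry in row \<open>i\<close> and column \<open>j\<close>, times
    \<open>b i\<close>, is a component of \<open>x * b j\<close>. Hence the row weight
    \<open>- dg (b i)\<close> and the column weight \<open>dg (x * b j)\<close>.\<close>
  define r where "r = (\<lambda>i. - dg (b i))"
  define c where "c = (\<lambda>j. dg (x * b j))"
  \<comment> \<open>Column \<open>j\<close> has its leading component in row \<open>i\<close>
    exactly when \<open>dg x + j\<close> is congruent to \<open>i\<close> modulo \<open>n\<close>;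
    \<open>\<pi>\<close> solves this for \<open>j\<close>.\<close>
  define \<pi> where "\<pi> = (\<lambda>i. if i < n then nat ((int i - dg x) mod int n) else i)"
  have A [simp]: "A \<in> carrier_mat n n"
    by (simp add: A_def)
  have A_eq: "A $$ (i, j) = \<iota> (coord b (x * b j) i)" if "i < n" "j < n" for i j
    using that by (simp add: A_def mult_mat_def)
  have \<pi>_lt: "\<pi> i < n" if "i < n" for i
    using that nat_mod_n by (simp add: \<pi>_def)
  have mod_iff: "(dg x + dg (b j)) mod int n = int i \<longleftrightarrow> j = \<pi> i" if "i < n" "j < n" for i j
  proof -
    have "(dg x + dg (b j)) mod int n = (dg x + int j) mod int n"
      using gradedD(2)[OF b that(2)] by (metis mod_add_right_eq)
    moreover have "(dg x + int j) mod int n = int i \<longleftrightarrow> int j = (int i - dg x) mod int n"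
    proof
      assume "(dg x + int j) mod int n = int i"
      then have "(int i - dg x) mod int n = (dg x + int j - dg x) mod int n"
        by (metis mod_diff_left_eq)
      then show "int j = (int i - dg x) mod int n"
        using that by simp
    next
      assume "int j = (int i - dg x) mod int n"
      then have "(dg x + int j) mod int n = (dg x + (int i - dg x)) mod int n"
        by (metis mod_add_right_eq)
      then show "(dg x + int j) mod int n = int i"
        using that by simp
    qed
    moreover have "int j = (int i - dg x) mod int n \<longleftrightarrow> j = \<pi> i"
      using that nat_mod_n[of "int i - dg x"] by (auto simp: \<pi>_def)
    ultimately show ?thesis
      by simp
  qed
  have "inj_on \<pi> {0..<n}"
  proof (rule inj_onI)
    fix i i' assume "i \<in> {0..<n}" "i' \<in> {0..<n}" "\<pi> i = \<pi> i'"
    then show "i = i'"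
      using mod_iff[of i "\<pi> i"] mod_iff[of i' "\<pi> i'"] \<pi>_lt by simp
  qed
  moreover from this have "\<pi> ` {0..<n} = {0..<n}"
    using \<pi>_lt by (intro endo_inj_surj) auto
  ultimately have "bij_betw \<pi> {0..<n} {0..<n}"
    by (simp add: bij_betw_def)
  then have \<pi>: "\<pi> permutes {0..<n}"
    by (rule bij_imp_permutes) (simp add: \<pi>_def)
  have xb: "x * b j \<noteq> 0" "dg (x * b j) = dg x + dg (b j)" if "j < n" for j
    using x gradedD(1)[OF b that] by (auto simp: dg_mult)
  have nz: "A $$ (i, \<pi> i) \<noteq> 0" and eq: "dg (A $$ (i, \<pi> i)) = r i + c (\<pi> i)" if i: "i < n" for i
  proof -
    note j = \<pi>_lt[OF i]
    have *: "coord b (x * b (\<pi> i)) i \<noteq> 0 \<and> dg (\<iota> (coord b (x * b (\<pi> i)) i) * b i) = dg (x * b (\<pi> i))"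
      using mod_iff[OF i j] xb[OF j] by (intro graded_coord(1)[OF b i]) auto
    then show "A $$ (i, \<pi> i) \<noteq> 0"
      using i j by (simp add: A_eq)
    show "dg (A $$ (i, \<pi> i)) = r i + c (\<pi> i)"
      using * i j gradedD(1)[OF b i] dg_mult[of "\<iota> (coord b (x * b (\<pi> i)) i)" "b i"]
      by (simp add: A_eq r_def c_def)
  qed
  have less: "bd (r i + c j - 1) (A $$ (i, j))" if i: "i < n" and j: "j < n" and ij: "j \<noteq> \<pi> i" for i j
  proof -
    have "bd (dg (x * b j) - 1) (\<iota> (coord b (x * b j) i) * b i)"
      using mod_iff[OF i j] xb[OF j] ij by (intro graded_coord(2)[OF b i]) auto
    then show ?thesis
      using i j gradedD(1)[OF b i]
      by (cases "coord b (x * b j) i = 0") (simp_all add: A_eq r_def c_def bd_def dg_mult)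
  qed
  have "det A \<noteq> 0" "dg (det A) = (\<Sum>i<n. r i) + (\<Sum>i<n. c i)"
    using dg_det[OF A \<pi> nz eq less] by auto
  moreover have "det A = \<iota> (ext_norm \<iota> x)"
    by (simp add: A_def ext_norm_eq[OF bs])
  \<comment> \<open>The degrees of the basis cancel. By \<open>dg_base\<close> the degree of the
    norm also carries a factor \<open>n\<close>, so comparison leaves \<open>dg x\<close>.\<close>
  moreover have "(\<Sum>i<n. r i) + (\<Sum>i<n. c i) = int n * dg x"
  proof -
    have "(\<Sum>i<n. c i) = (\<Sum>i<n. dg x + dg (b i))"
      by (rule sum.cong) (auto simp: c_def xb)
    then show ?thesis
      by (simp add: r_def sum.distrib sum_negf)
  qed
  ultimately show "ext_norm \<iota> x \<noteq> 0" "int_deg_infty (ext_norm \<iota> x) = dg x"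
    using n_pos dg_base[of "ext_norm \<iota> x"] by auto
qed

lemma ext_norm_0: "ext_norm \<iota> 0 = 0"
proof -
  obtain b where b: "basis b"
    by (rule mult_matrix_SOME)
  have "mult_mat b 0 = 0\<^sub>m n n"
    using coord_scale[OF b, of 0 0] by (intro eq_matI) (auto simp: mult_mat_def)
  then show ?thesis
    using n_pos by (simp add: ext_norm_eq[OF b])
qed

lemma deg_infty_ext_norm:
  "deg_infty (ext_norm \<iota> x) = (if x = 0 then - \<infinity> else ereal (of_int (dg x)))"
  using ext_norm_dg[of x] by (simp add: deg_infty_def ext_norm_0)

text \<open>A diagonal entry times \<open>b i\<close> is a component of \<open>x * b i\<close>, and
  the degree of \<open>b i\<close> cancels.\<close>

lemma bd_trace:
  assumes "x \<noteq> 0"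
  shows "bd (dg x) (\<iota> (ext_trace \<iota> x))"
proof -
  obtain b where b: "graded b"
    using ex_graded by blast
  have "bd (dg x) (\<iota> (coord b (x * b i) i))" if i: "i < n" for i
  proof -
    note bi = gradedD(1)[OF b i]
    have "bd (dg (x * b i)) (\<iota> (coord b (x * b i) i) * b i)"
      using graded_coord[OF b i, of "x * b i"] assms bi
      by (cases "dg (x * b i) mod int n = int i") (auto simp: bd_def)
    then show ?thesis
      using assms bi by (cases "coord b (x * b i) i = 0") (simp_all add: bd_def dg_mult)
  qed
  then show ?thesis
    by (auto simp: ext_trace_eq[OF graded_basis[OF b]] hom_distribs intro!: bd_sum)
qed

text \<open>Traces lie in k(T), where degrees are multiples of \<open>n\<close>, so the bound of
  \<open>bd_trace\<close> cannot be attained.\<close>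

lemma bd_trace_less:
  assumes "x \<noteq> 0" "dg x mod int n \<noteq> 0"
  shows "bd (dg x - 1) (\<iota> (ext_trace \<iota> x))"
proof (cases "ext_trace \<iota> x = 0")
  case False
  then have "dg (\<iota> (ext_trace \<iota> x)) mod int n = 0"
    by (simp add: dg_base)
  then show ?thesis
    using bd_trace[OF assms(1)] assms(2) by (auto simp: bd_def)
qed simp

text \<open>The component \<open>\<iota> q\<close> of \<open>x\<close> in k(T) carries the leading
  term, and its trace is \<open>n * q\<close>. As \<open>n\<close> is a nonzero constant of k, the
  degree is unchanged, while the trace of the rest is of smaller degree.\<close>

lemma dg_trace_eq:
  assumes x: "x \<noteq> 0" "dg x mod int n = 0" and char: "\<not> CHAR('k) dvd n"
  shows "ext_trace \<iota> x \<noteq> 0" "dg (\<iota> (ext_trace \<iota> x)) = dg x"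
proof -
  obtain b where b: "graded b" "b 0 = 1"
    using ex_graded by blast
  define q where "q = coord b x 0"
  have q: "q \<noteq> 0" "dg (\<iota> q) = dg x"
    using graded_coord(1)[OF b(1) n_pos x(1)] x(2) b(2) by (auto simp: q_def)
  define y where "y = (\<Sum>i\<in>{..<n} - {0}. \<iota> (coord b x i) * b i)"
  have "x = (\<Sum>i<n. \<iota> (coord b x i) * b i)"
    using basis_expand[OF graded_basis[OF b(1)]] by simp
  also have "\<dots> = \<iota> q + y"
    using n_pos b(2) by (subst sum.remove[of _ 0]) (auto simp: q_def y_def)
  finally have xy: "x = \<iota> q + y" .
  have "bd (dg x - 1) y"
    using graded_coord(2)[OF b(1) _ x(1)] x(2) by (auto simp: y_def intro!: bd_sum)
  then have y: "bd (dg x - 1) (\<iota> (ext_trace \<iota> y))"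
    using bd_trace[of y] ext_trace_base[of 0] by (cases "y = 0") (auto simp: bd_def)
  have "of_nat n \<noteq> (0 :: 'k)"
    using char by (simp add: of_nat_eq_0_iff_char_dvd)
  then have nz: "(of_nat n :: 'k poly) \<noteq> 0"
    by (simp add: of_nat_poly)
  have n0: "\<iota> (of_nat n) \<noteq> 0" "dg (\<iota> (of_nat n)) = 0"
  proof -
    have "\<iota> (of_nat n) = h (of_nat n)"
      by (simp add: hom_distribs h.hom_of_nat)
    then show "\<iota> (of_nat n) \<noteq> 0" "dg (\<iota> (of_nat n)) = 0"
      using nz dg_h[OF nz] by (simp_all add: degree_of_nat)
  qed
  have "\<iota> (ext_trace \<iota> x) = \<iota> (of_nat n) * \<iota> q + \<iota> (ext_trace \<iota> y)"
    unfolding xy by (simp add: ext_trace_add ext_trace_base hom_distribs)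
  moreover have "\<iota> (of_nat n) * \<iota> q \<noteq> 0" "dg (\<iota> (of_nat n) * \<iota> q) = dg x"
    using n0 q by (auto simp: dg_mult)
  ultimately show "ext_trace \<iota> x \<noteq> 0" "dg (\<iota> (ext_trace \<iota> x)) = dg x"
    using dg_add_eq[of "\<iota> (of_nat n) * \<iota> q" "\<iota> (ext_trace \<iota> y)"] y by auto
qed

lemma ex_leading_const:
  assumes "q \<noteq> 0" "int_deg_infty q = 0"
  shows "\<exists>c. c \<noteq> 0 \<and> bd (- 1) (\<iota> q - h [:c:])"
proof -
  obtain f g where fg: "q = Fract f g" "g \<noteq> 0"
    by (cases q) auto
  then have f: "f \<noteq> 0"
    using assms(1) by (auto simp: Zero_fract_def eq_fract)
  have deg: "degree f = degree g"
    using assms(2) int_deg_infty_Fract[OF f fg(2)] fg(1) by simp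
  \<comment> \<open>Numerator and denominator have equal degree, so the value of \<open>q\<close> at
    infinity is the quotient of the leading coefficients. The numerator \<open>r\<close> of
    \<open>q - c\<close> vanishes or has smaller degree.\<close>
  define c where "c = lead_coeff f / lead_coeff g"
  define r where "r = f - Polynomial.smult c g"
  have c: "c \<noteq> 0"
    using f fg(2) by (simp add: c_def)
  have r: "r = 0 \<or> degree r < degree g"
  proof (cases "degree g = 0")
    case True
    then show ?thesis
      using deg fg(2) by (auto simp: r_def c_def elim!: degree_eq_zeroE)
  next
    case False
    have "degree r \<le> degree g"
      unfolding r_def using deg by (intro degree_diff_le degree_smult_le[THEN order_trans]) auto
    moreover have "coeff r (degree g) = 0"
      using deg fg(2) by (simp add: r_def c_def)
    ultimately show ?thesis
      using False by (metis leading_coeff_0_iff le_neq_implies_less)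
  qed
  have "q * to_fract g = to_fract f"
    using fg by (simp add: Fract_conv_to_fract)
  then have "\<iota> q * h g = h f"
    by (metis h_def hom_mult)
  moreover have "h r = h f - h [:c:] * h g"
    by (simp add: r_def h.hom_minus flip: h.hom_mult)
  ultimately have "(\<iota> q - h [:c:]) * h g = h r"
    by (simp add: left_diff_distrib)
  moreover have "bd (dg (h g) - 1) (h r)"
    using r n_pos fg(2) by (cases "r = 0") (simp_all add: bd_def dg_h)
  ultimately have "bd (- 1) (\<iota> q - h [:c:])"
    using fg(2) dg_mult[of "\<iota> q - h [:c:]" "h g"]
    by (cases "\<iota> q - h [:c:] = 0") (auto simp: bd_def)
  then show ?thesis
    using c by blast
qed

text \<open>The residue field at infinity is \<open>k\<close>.\<close>

lemma ex_same_leading: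
  assumes x: "x \<noteq> 0" and y: "y \<noteq> 0" and eq: "dg x = dg y"
  shows "\<exists>c. c \<noteq> 0 \<and> bd (dg x - 1) (x - h [:c:] * y)"
proof -
  obtain b where b: "graded b" "b 0 = 1"
    using ex_graded by blast
  \<comment> \<open>The quotient has degree 0, so its leading part is the coordinate at
    \<open>b 0 = 1\<close>, an element of k(T) with leading constant \<open>c\<close>.\<close>
  define u where "u = x / y"
  have u: "u \<noteq> 0" "u * y = x"
    using x y by (auto simp: u_def)
  then have dgu: "dg u = 0"
    using dg_mult[of u y] y eq by simp
  define q where "q = coord b u 0"
  have q: "q \<noteq> 0" "dg (\<iota> q) = 0"
    using graded_coord(1)[OF b(1) n_pos u(1)] b(2) dgu by (auto simp: q_def)
  then have "int_deg_infty q = 0"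
    using dg_base[of q] n_pos by simp
  then obtain c where c: "c \<noteq> 0" "bd (- 1) (\<iota> q - h [:c:])"
    using ex_leading_const q(1) by blast
  define z where "z = (\<Sum>i\<in>{..<n} - {0}. \<iota> (coord b u i) * b i)"
  have "u = (\<Sum>i<n. \<iota> (coord b u i) * b i)"
    using basis_expand[OF graded_basis[OF b(1)]] by simp
  also have "\<dots> = \<iota> q + z"
    using n_pos b(2) by (subst sum.remove[of _ 0]) (auto simp: q_def z_def)
  finally have eq': "u - h [:c:] = (\<iota> q - h [:c:]) + z"
    by simp
  moreover have "bd (- 1) z"
    using graded_coord(2)[OF b(1) _ u(1)] dgu by (auto simp: z_def intro!: bd_sum)
  ultimately have "bd (- 1) (u - h [:c:])"
    unfolding eq' using c by (intro bd_add)
  then have "bd (- 1 + dg y) ((u - h [:c:]) * y)"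
    using bd_dg by (rule bd_mult)
  moreover have "(u - h [:c:]) * y = x - h [:c:] * y"
    using u(2) by (simp add: left_diff_distrib)
  ultimately show ?thesis
    using c(1) eq by auto
qed

end

subsection \<open>Integral elements\<close>

context function_field_extension
begin

section \<open>Closure of integral elements under ring operations\<close>

lemma ring_of_integers_altdef:
  "ring_of_integers \<iota> = {x. \<exists>p. lead_coeff p = 1 \<and> poly (map_poly h p) x = 0}"
proof -
  have "h = (\<lambda>a. \<iota> (to_fract a))"
    by (simp add: fun_eq_iff h_def)
  then show ?thesis
    by (simp add: ring_of_integers_def)
qed

text \<open>The determinant trick: multiplication by \<open>z\<close> on the generators is given by
  a matrix over k[T], and \<open>z\<close> is a root of its monic characteristic polynomial. The
  nonzero \<open>b\<close> makes the eigenvector nonzero.\<close>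

lemma integralI_span:
  assumes "finite B" "b \<in> B" "b \<noteq> 0" and stable: "\<And>b. b \<in> B \<Longrightarrow> z * b \<in> hm.span B"
  shows "z \<in> ring_of_integers \<iota>"
proof -
  obtain ms where ms: "distinct ms" "set ms = B"
    using finite_distinct_list[OF assms(1)] by blast
  define N where "N = length ms"
  have "\<exists>u. z * b = (\<Sum>v\<in>B. h (u v) * v)" if "b \<in> B" for b
    using stable[OF that] by (auto simp: hm.span_finite[OF assms(1)])
  then obtain u where u: "z * b = (\<Sum>v\<in>B. h (u b v) * v)" if "b \<in> B" for b
    by metis
  define A where "A = mat N N (\<lambda>(i, j). u (ms ! i) (ms ! j))"
  define w where "w = vec N (nth ms)"
  have A: "A \<in> carrier_mat N N" "map_mat h A \<in> carrier_mat N N"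
    by (simp_all add: A_def)
  have "map_mat h A *\<^sub>v w = z \<cdot>\<^sub>v w"
  proof (rule eq_vecI)
    fix i assume "i < dim_vec (z \<cdot>\<^sub>v w)"
    then have i: "i < N"
      by (simp add: w_def)
    have "(\<Sum>j<N. h (u (ms ! i) (ms ! j)) * ms ! j) = (\<Sum>v\<in>B. h (u (ms ! i) v) * v)"
      using ms by (intro sum.reindex_bij_betw bij_betw_nth) (simp_all add: N_def)
    also have "\<dots> = z * ms ! i"
      using u[of "ms ! i"] i ms nth_mem[of i ms] by (simp add: N_def)
    finally show "(map_mat h A *\<^sub>v w) $ i = (z \<cdot>\<^sub>v w) $ i"
      using i by (simp add: A_def w_def scalar_prod_def atLeast0LessThan)
  qed (simp add: A_def w_def)
  moreover obtain i where "i < N" "ms ! i = b"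
    using assms(2) ms by (auto simp: N_def in_set_conv_nth)
  then have "w $ i \<noteq> 0\<^sub>v N $ i"
    using assms(3) by (simp add: w_def)
  then have "w \<noteq> 0\<^sub>v N"
    by metis
  ultimately have "eigenvalue (map_mat h A) z"
    unfolding eigenvalue_def eigenvector_def by (intro exI[of _ w]) (simp add: A_def w_def)
  then have "poly (map_poly h (char_poly A)) z = 0"
    using eigenvalue_root_char_poly[OF A(2)] h.char_poly_hom[OF A(1)] by simp
  moreover have "lead_coeff (char_poly A) = 1"
    using degree_monic_char_poly[OF A(1)] by simp
  ultimately show ?thesis
    by (auto simp: ring_of_integers_altdef)
qed

lemma integral_power_in_span:
  assumes "x \<in> ring_of_integers \<iota>"
  shows "\<exists>d>0. x ^ d \<in> hm.span ((\<lambda>i. x ^ i) ` {..<d})"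
proof -
  obtain p where p: "lead_coeff p = 1" "poly (map_poly h p) x = 0"
    using assms by (auto simp: ring_of_integers_altdef)
  define d where "d = degree p"
  have sum: "(\<Sum>i\<le>d. h (coeff p i) * x ^ i) = 0"
    using p(2) by (simp add: poly_altdef d_def)
  have "d > 0"
  proof (rule ccontr)
    assume "\<not> d > 0"
    then show False
      using sum p(1) by (simp add: d_def)
  qed
  have "(\<Sum>i<d. h (coeff p i) * x ^ i) + x ^ d = 0"
    using sum p(1) by (simp add: d_def flip: lessThan_Suc_atMost)
  then have "x ^ d = - (\<Sum>i<d. h (coeff p i) * x ^ i)"
    by (simp add: eq_neg_iff_add_eq_0 add.commute)
  also have "\<dots> \<in> hm.span ((\<lambda>i. x ^ i) ` {..<d})"
    by (intro hm.span_neg hm.span_sum hm.span_scale hm.span_base) auto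
  finally show ?thesis
    using \<open>d > 0\<close> by blast
qed

lemma mult_span:
  assumes "\<And>b. b \<in> B \<Longrightarrow> x * b \<in> hm.span C" "u \<in> hm.span B"
  shows "x * u \<in> hm.span C"
proof -
  have "hm.subspace {u. x * u \<in> hm.span C}"
    by (rule hm.subspaceI)
      (auto simp: distrib_left mult.left_commute[of x] intro: hm.span_add hm.span_scale hm.span_zero)
  then have "hm.span B \<subseteq> {u. x * u \<in> hm.span C}"
    using assms(1) by (intro hm.span_minimal) auto
  then show ?thesis
    using assms(2) by blast
qed

text \<open>Only the top exponent leaves the set of powers, and the relation for
  \<open>x ^ d\<close> brings it back. The factor \<open>c\<close> allows a power of a second
  integral element alongside.\<close>

lemma integral_power_stable:
  assumes "x ^ d \<in> hm.span ((\<lambda>i. x ^ i) ` {..<d})" "i < d"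
    and B: "(\<lambda>i. c * x ^ i) ` {..<d} \<subseteq> B"
  shows "x * (c * x ^ i) \<in> hm.span B"
proof (cases "Suc i = d")
  case True
  have "c * x ^ d \<in> hm.span B"
    using B by (intro mult_span[OF _ assms(1)] hm.span_base) auto
  then show ?thesis
    using True by (metis mult.left_commute power_Suc)
next
  case False
  then have "c * x ^ Suc i \<in> (\<lambda>i. c * x ^ i) ` {..<d}"
    using assms(2) by (intro rev_image_eqI[of "Suc i"]) auto
  then have "c * x ^ Suc i \<in> hm.span B"
    using B by (blast intro: hm.span_base)
  then show ?thesis
    by (simp add: mult.left_commute)
qed

lemma integral_add_mult:
  assumes "x \<in> ring_of_integers \<iota>" "y \<in> ring_of_integers \<iota>"
  shows "x + y \<in> ring_of_integers \<iota>" "x * y \<in> ring_of_integers \<iota>"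
proof -
  obtain d where d: "d > 0" "x ^ d \<in> hm.span ((\<lambda>i. x ^ i) ` {..<d})"
    using integral_power_in_span[OF assms(1)] by blast
  obtain e where e: "e > 0" "y ^ e \<in> hm.span ((\<lambda>i. y ^ i) ` {..<e})"
    using integral_power_in_span[OF assms(2)] by blast
  \<comment> \<open>The span of these monomials is stable under multiplication by \<open>x\<close>
    and by \<open>y\<close>, hence by their sum and product.\<close>
  define B where "B = (\<lambda>(i, j). x ^ i * y ^ j) ` ({..<d} \<times> {..<e})"
  have fin: "finite B"
    by (simp add: B_def)
  have one: "1 \<in> B"
    using d(1) e(1) by (auto simp: B_def intro!: rev_image_eqI[of "(0, 0)"])
  have x: "x * b \<in> hm.span B" if bB: "b \<in> B" for b
  proof -
    obtain i j where ij: "i < d" "j < e" "b = x ^ i * y ^ j"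
      using bB by (auto simp: B_def)
    have "(\<lambda>i. y ^ j * x ^ i) ` {..<d} \<subseteq> B"
      using ij(2) by (auto simp: B_def mult.commute[of "y ^ j"])
    from integral_power_stable[OF d(2) ij(1) this] show ?thesis
      by (simp add: ij(3) mult.commute[of "x ^ i"])
  qed
  have y: "y * b \<in> hm.span B" if bB: "b \<in> B" for b
  proof -
    obtain i j where ij: "i < d" "j < e" "b = x ^ i * y ^ j"
      using bB by (auto simp: B_def)
    have "(\<lambda>j. x ^ i * y ^ j) ` {..<e} \<subseteq> B"
      using ij(1) by (auto simp: B_def)
    from integral_power_stable[OF e(2) ij(2) this] show ?thesis
      by (simp add: ij(3))
  qed
  show "x + y \<in> ring_of_integers \<iota>"
    using x y by (intro integralI_span[OF fin one]) (auto simp: distrib_right intro: hm.span_add)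
  show "x * y \<in> ring_of_integers \<iota>"
    using mult_span[OF x y] by (intro integralI_span[OF fin one]) (auto simp: mult.assoc)
qed

lemma h_integral: "h p \<in> ring_of_integers \<iota>"
  by (auto simp: ring_of_integers_altdef h.hom_uminus intro!: exI[of _ "[:- p, 1:]"])

lemma integral_scale: "x \<in> ring_of_integers \<iota> \<Longrightarrow> h p * x \<in> ring_of_integers \<iota>"
  by (rule integral_add_mult(2)[OF h_integral])

lemma integral_diff:
  assumes "x \<in> ring_of_integers \<iota>" "y \<in> ring_of_integers \<iota>"
  shows "x - y \<in> ring_of_integers \<iota>"
  using integral_add_mult(1)[OF assms(1) integral_scale[OF assms(2), of "- 1"]]
  by (simp add: h.hom_uminus)

lemma integral_0: "0 \<in> ring_of_integers \<iota>"
  using h_integral[of 0] by simp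

lemma integral_sum:
  "(\<And>i. i \<in> A \<Longrightarrow> f i \<in> ring_of_integers \<iota>) \<Longrightarrow> sum f A \<in> ring_of_integers \<iota>"
  by (induction A rule: infinite_finite_induct) (auto intro: integral_add_mult integral_0)

end

section \<open>Denominators and lattices over k[T]\<close>

lemma common_denominator:
  fixes f :: "'i \<Rightarrow> 'a::idom fract"
  assumes "finite I"
  shows "\<exists>t. t \<noteq> 0 \<and> (\<forall>i\<in>I. \<exists>p. to_fract t * f i = to_fract p)"
  using assms
proof (induction I)
  case empty
  then show ?case
    by (auto intro: exI[of _ 1])
next
  case (insert x I)
  then obtain t where t: "t \<noteq> 0" "\<And>i. i \<in> I \<Longrightarrow> \<exists>p. to_fract t * f i = to_fract p"
    by blast
  obtain a b where ab: "f x = Fract a b" "b \<noteq> 0"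
    by (cases "f x") auto
  have "\<exists>p. to_fract (t * b) * f i = to_fract p" if i: "i \<in> insert x I" for i
  proof (cases "i = x")
    case True
    then have "to_fract (t * b) * f i = to_fract (t * a)"
      using ab by (simp add: Fract_conv_to_fract)
    then show ?thesis
      by blast
  next
    case False
    then obtain p where "to_fract t * f i = to_fract p"
      using t(2) i by blast
    then have "to_fract (t * b) * f i = to_fract (b * p)"
      by (simp add: mult_ac flip: mult.assoc)
    then show ?thesis
      by blast
  qed
  then show ?case
    using t(1) ab(2) by (intro exI[of _ "t * b"]) auto
qed

context totally_ramified
begin

text \<open>A lattice over k[T] with coefficients indexed by position, so that
  \<open>graded_sum\<close> and \<open>coord_unique\<close> apply directly.\<close>

definition poly_span :: "(nat \<Rightarrow> 'l) \<Rightarrow> 'l set" where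
  "poly_span b = {x. \<exists>p. x = (\<Sum>i<n. h (p i) * b i)}"

lemma poly_spanI: "(\<Sum>i<n. h (p i) * b i) \<in> poly_span b"
  by (auto simp: poly_span_def)

lemma subspace_poly_span: "hm.subspace (poly_span b)"
proof (rule hm.subspaceI)
  show "0 \<in> poly_span b"
    using poly_spanI[of "\<lambda>_. 0" b] by simp
next
  fix x y assume "x \<in> poly_span b" "y \<in> poly_span b"
  then obtain p q where "x = (\<Sum>i<n. h (p i) * b i)" "y = (\<Sum>i<n. h (q i) * b i)"
    by (auto simp: poly_span_def)
  then have "x + y = (\<Sum>i<n. h (p i + q i) * b i)"
    by (simp add: h.hom_add distrib_right sum.distrib)
  then show "x + y \<in> poly_span b"
    using poly_spanI[of "\<lambda>i. p i + q i" b] by simp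
next
  fix c x assume "x \<in> poly_span b"
  then obtain p where "x = (\<Sum>i<n. h (p i) * b i)"
    by (auto simp: poly_span_def)
  then have "h c * x = (\<Sum>i<n. h (c * p i) * b i)"
    by (simp add: sum_distrib_left)
  then show "h c * x \<in> poly_span b"
    using poly_spanI[of "\<lambda>i. c * p i" b] by simp
qed

lemma poly_span_base: "i < n \<Longrightarrow> b i \<in> poly_span b"
proof -
  assume i: "i < n"
  have "(\<Sum>j<n. h (if j = i then 1 else 0) * b j) = (\<Sum>j<n. if j = i then b i else 0)"
    by (intro sum.cong) auto
  then show ?thesis
    using poly_spanI[of "\<lambda>j. if j = i then 1 else 0" b] i by simp
qed

lemma dg_poly_span_nonneg:
  assumes b: "graded b" "\<And>i. i < n \<Longrightarrow> dg (b i) \<ge> 0" and x: "x \<in> poly_span b" "x \<noteq> 0"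
  shows "dg x \<ge> 0"
proof -
  obtain p where p: "x = (\<Sum>i<n. h (p i) * b i)"
    using x(1) by (auto simp: poly_span_def)
  then obtain i where i: "i < n" "p i \<noteq> 0"
    using x(2) by (metis (no_types, lifting) h.hom_zero lessThan_iff mult_zero_left sum.neutral)
  then obtain j where j: "j < n" "p j \<noteq> 0" "dg (h (p j) * b j) = dg x"
    using graded_sum(2)[OF b(1), of x "to_fract \<circ> p" i] p by (auto simp: h_def)
  have "dg x = dg (h (p j)) + dg (b j)"
    using j gradedD(1)[OF b(1) j(1)] by (simp add: dg_mult flip: j(3))
  then show ?thesis
    using b(2)[OF j(1)] dg_h[OF j(2)] by simp
qed

lemma denominator_poly_span:
  assumes "basis b" and "finite I"
  shows "\<exists>t. t \<noteq> 0 \<and> (\<forall>i\<in>I. h t * f i \<in> poly_span b)"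
proof -
  obtain t where t: "t \<noteq> 0"
    "\<And>i j. i \<in> I \<Longrightarrow> j < n \<Longrightarrow> \<exists>p. to_fract t * coord b (f i) j = to_fract p"
    using common_denominator[of "I \<times> {..<n}" "\<lambda>(i, j). coord b (f i) j"] assms(2) by auto
  have "h t * f i \<in> poly_span b" if i: "i \<in> I" for i
  proof -
    obtain p where p: "\<And>j. j < n \<Longrightarrow> to_fract t * coord b (f i) j = to_fract (p j)"
      using t(2)[OF i] by metis
    have "h t * f i = h t * (\<Sum>j<n. \<iota> (coord b (f i) j) * b j)"
      by (simp add: basis_expand[OF assms(1)])
    also have "\<dots> = (\<Sum>j<n. \<iota> (to_fract t * coord b (f i) j) * b j)"
      by (simp add: h_def hom_mult sum_distrib_left mult.assoc)
    also have "\<dots> = (\<Sum>j<n. h (p j) * b j)"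
      using p by (simp add: h_def)
    finally show ?thesis
      using poly_spanI by simp
  qed
  then show ?thesis
    using t(1) by blast
qed

text \<open>Powers of an integral element have bounded denominators, so their degrees
  are bounded below.\<close>

lemma integral_dg_nonneg:
  assumes y: "y \<in> ring_of_integers \<iota>" "y \<noteq> 0"
  shows "dg y \<ge> 0"
proof (rule ccontr)
  assume neg: "\<not> dg y \<ge> 0"
  obtain d where d: "d > 0" "y ^ d \<in> hm.span ((\<lambda>i. y ^ i) ` {..<d})"
    using integral_power_in_span[OF y(1)] by blast
  define S where "S = (\<lambda>i. y ^ i) ` {..<d}"
  have stable: "y * s \<in> hm.span S" if "s \<in> S" for s
    using that integral_power_stable[OF d(2), of _ 1 S] by (auto simp: S_def)
  have pow: "y ^ m \<in> hm.span S" for m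
  proof (induction m)
    case 0
    have "y ^ 0 \<in> S"
      unfolding S_def using d(1) by blast
    then show ?case
      by (rule hm.span_base)
  next
    case (Suc m)
    then show ?case
      using mult_span[OF stable] by simp
  qed
  obtain b where b: "graded b" "\<And>i. i < n \<Longrightarrow> dg (b i) = int i"
    using ex_graded by blast
  obtain t where t: "t \<noteq> 0" "\<And>s. s \<in> S \<Longrightarrow> h t * s \<in> poly_span b"
    using denominator_poly_span[OF graded_basis[OF b(1)], of S id] by (auto simp: S_def)
  have "hm.subspace {u. h t * u \<in> poly_span b}"
    using subspace_poly_span[of b]
    by (intro hm.subspaceI)
      (auto simp: distrib_left mult.left_commute[of "h t"] hm.subspace_add hm.subspace_scale hm.subspace_0
        simp del: hm.scale_scale)
  then have "hm.span S \<subseteq> {u. h t * u \<in> poly_span b}"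
    using t(2) by (intro hm.span_minimal) auto
  then have lat: "h t * y ^ m \<in> poly_span b" for m
    using pow by blast
  \<comment> \<open>Each factor \<open>y\<close> lowers the degree by at least one, so this exponent
    would push \<open>h t * y ^ m\<close> below degree 0.\<close>
  define m where "m = Suc (nat (dg (h t)))"
  have nz: "h t * y ^ m \<noteq> 0"
    using t(1) y(2) by simp
  have "dg (h t * y ^ m) \<ge> 0"
    using dg_poly_span_nonneg[OF b(1) _ lat nz] b(2) by simp
  then have "dg (h t) + int m * dg y \<ge> 0"
    using t(1) y(2) by (simp add: dg_mult dg_power)
  moreover have "int m * dg y \<le> int m * (- 1)"
    using neg by (intro mult_left_mono) auto
  moreover have "int m > dg (h t)"
    by (simp add: m_def)
  ultimately show False
    by linarith
qed

text \<open>Clearing the denominators of multiplication by \<open>x\<close> in a basis gives a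
  multiple of \<open>x\<close> that maps a lattice into itself, so \<open>integralI_span\<close>
  applies.\<close>

lemma ex_integral_multiple: "\<exists>t. t \<noteq> 0 \<and> h t * x \<in> ring_of_integers \<iota>"
proof -
  obtain b where b: "graded b"
    using ex_graded by blast
  obtain t where t: "t \<noteq> 0" "\<And>i. i < n \<Longrightarrow> h t * (x * b i) \<in> poly_span b"
    using denominator_poly_span[OF graded_basis[OF b], of "{..<n}" "\<lambda>i. x * b i"] by auto
  have "poly_span b \<subseteq> hm.span (b ` {..<n})"
    unfolding poly_span_def by (auto intro!: hm.span_sum[OF hm.span_scale] intro: hm.span_base)
  then have "h t * x \<in> ring_of_integers \<iota>"
    using t(2) n_pos gradedD(1)[OF b n_pos]
    by (intro integralI_span[of "b ` {..<n}" "b 0"]) (auto simp: mult.assoc)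
  then show ?thesis
    using t(1) by blast
qed

text \<open>The degrees of an Apery family form the Apery set, with respect to \<open>n\<close>, of the numerical
  semigroup of degrees of integral elements.\<close>

definition apery :: "(nat \<Rightarrow> 'l) \<Rightarrow> bool" where
  "apery w \<longleftrightarrow> graded w \<and> (\<forall>i<n. w i \<in> ring_of_integers \<iota>) \<and>
     (\<forall>y\<in>ring_of_integers \<iota>. y \<noteq> 0 \<longrightarrow> dg (w (nat (dg y mod int n))) \<le> dg y)"

lemma aperyD:
  assumes "apery w"
  shows "graded w" "i < n \<Longrightarrow> w i \<in> ring_of_integers \<iota>"
    "y \<in> ring_of_integers \<iota> \<Longrightarrow> y \<noteq> 0 \<Longrightarrow> dg (w (nat (dg y mod int n))) \<le> dg y"
  using assms by (auto simp: apery_def)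

section \<open>Apery families as integral bases\<close>

lemma ex_apery: "\<exists>w. apery w"
proof -
  define P where "P = (\<lambda>i y. y \<in> ring_of_integers \<iota> \<and> y \<noteq> 0 \<and> dg y mod int n = int i)"
  obtain b where b: "graded b"
    using ex_graded by blast
  have "\<exists>w. P i w \<and> (\<forall>y. P i y \<longrightarrow> dg w \<le> dg y)" if i: "i < n" for i
  proof -
    \<comment> \<open>The residue class of \<open>i\<close> contains an integral element, since
      multiplying \<open>b i\<close> by a nonzero polynomial preserves the residue.\<close>
    obtain t where t: "t \<noteq> 0" "h t * b i \<in> ring_of_integers \<iota>"
      using ex_integral_multiple by blast
    have "P i (h t * b i)"
      using t gradedD(1)[OF b i] graded_term_mod(2)[OF b i, of "to_fract t"]
      by (simp add: P_def h_def)
    \<comment> \<open>Truncating degrees to natural numbers loses nothing, since integral degrees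
      are nonnegative.\<close>
    then obtain w where w: "P i w" "\<And>y. P i y \<Longrightarrow> nat (dg w) \<le> nat (dg y)"
      using ex_has_least_nat[of "P i" _ "nat \<circ> dg"] by auto
    have "dg w \<le> dg y" if "P i y" for y
      using w(2)[OF that] that integral_dg_nonneg[of y] by (simp add: P_def nat_le_eq_zle)
    then show ?thesis
      using w(1) by blast
  qed
  then obtain w where w: "\<And>i. i < n \<Longrightarrow> P i (w i)" "\<And>i y. i < n \<Longrightarrow> P i y \<Longrightarrow> dg (w i) \<le> dg y"
    by metis
  have "apery w"
    unfolding apery_def graded_def
  proof (intro conjI allI impI ballI)
    fix y assume "y \<in> ring_of_integers \<iota>" "y \<noteq> 0"
    then have "P (nat (dg y mod int n)) y"
      using n_pos by (simp add: P_def)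
    then show "dg (w (nat (dg y mod int n))) \<le> dg y"
      by (intro w(2) nat_mod_n)
  qed (use w(1) in \<open>auto simp: P_def\<close>)
  then show ?thesis
    by blast
qed

text \<open>Multiplying by \<open>T\<close> raises the degree by \<open>n\<close>, so monomial
  multiples of one \<open>w r\<close> reach every larger degree in its residue class.\<close>

lemma apery_monom:
  assumes w: "apery w" and m: "dg (w (nat (m mod int n))) \<le> m"
  shows "\<exists>k. h (monom 1 k) * w (nat (m mod int n)) \<noteq> 0 \<and> dg (h (monom 1 k) * w (nat (m mod int n))) = m"
proof -
  define r where "r = nat (m mod int n)"
  note r = nat_mod_n[of m, folded r_def]
  note wr = gradedD[OF aperyD(1)[OF w] r(2)]
  have "m mod int n = dg (w r) mod int n"
    using r(1) wr(2) by simp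
  then have "int n dvd m - dg (w r)"
    by (simp only: mod_eq_dvd_iff)
  then obtain k where k: "m - dg (w r) = int n * k"
    by (elim dvdE)
  have "0 \<le> int n * k"
    using m by (simp add: r_def flip: k)
  then have "k \<ge> 0"
    using n_pos by (simp add: zero_le_mult_iff)
  have nz: "monom (1 :: 'k) (nat k) \<noteq> 0"
    by (simp add: monom_eq_0_iff)
  then have "dg (h (monom 1 (nat k)) * w r) = m"
    using wr(1) k \<open>k \<ge> 0\<close> by (simp add: dg_mult dg_h degree_monom_eq)
  then show ?thesis
    using nz wr(1) by (auto simp: r_def)
qed

text \<open>Division by leading terms: a constant times a monomial times \<open>w r\<close> cancels
  the leading term of an integral \<open>y\<close>. The difference is again integral and vanishes or
  has smaller degree; as integral degrees are nonnegative, the process ends at 0.\<close>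

lemma apery_poly_span:
  assumes w: "apery w"
  shows "ring_of_integers \<iota> = poly_span w"
proof
  show "poly_span w \<subseteq> ring_of_integers \<iota>"
    using aperyD(2)[OF w] by (auto simp: poly_span_def intro!: integral_sum integral_scale)
  have "y \<in> poly_span w" if "y \<in> ring_of_integers \<iota>" for y
    using that
  proof (induction "nat (dg y)" arbitrary: y rule: less_induct)
    case less
    show ?case
    proof (cases "y = 0")
      case True
      then show ?thesis
        using hm.subspace_0[OF subspace_poly_span] by simp
    next
      case False
      define r where "r = nat (dg y mod int n)"
      have r: "r < n"
        by (simp add: r_def nat_mod_n)
      obtain k where z: "h (monom 1 k) * w r \<noteq> 0" "dg (h (monom 1 k) * w r) = dg y"
        using apery_monom[OF w aperyD(3)[OF w less.prems False]] by (auto simp: r_def)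
      obtain c where c: "bd (dg y - 1) (y - h [:c:] * (h (monom 1 k) * w r))"
        using ex_same_leading[OF False z(1)] z(2) by auto
      define y' where "y' = y - h [:c:] * (h (monom 1 k) * w r)"
      have y': "y' \<in> ring_of_integers \<iota>"
        unfolding y'_def using less.prems aperyD(2)[OF w r]
        by (intro integral_diff integral_scale)
      have "y' \<in> poly_span w"
      proof (cases "y' = 0")
        case True
        then show ?thesis
          using hm.subspace_0[OF subspace_poly_span] by simp
      next
        case False
        then have "dg y' < dg y"
          using c by (simp add: y'_def bd_def)
        then show ?thesis
          using less.hyps[of y'] y' integral_dg_nonneg[OF y' False] by simp
      qed
      moreover have "h [:c:] * (h (monom 1 k) * w r) \<in> poly_span w"
        by (intro hm.subspace_scale subspace_poly_span poly_span_base r)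
      moreover have "y = y' + h [:c:] * (h (monom 1 k) * w r)"
        by (simp add: y'_def)
      ultimately show ?thesis
        using hm.subspace_add[OF subspace_poly_span] by metis
    qed
  qed
  then show "ring_of_integers \<iota> \<subseteq> poly_span w"
    by blast
qed

end

subsection \<open>Discriminant and Euclidean minimum\<close>

context totally_ramified
begin

text \<open>The partner of \<open>i\<close> such that the two indices sum to \<open>m\<close> modulo
  \<open>n\<close>; this is an involution. Indices from \<open>n\<close> on are fixed, as
  \<open>permutes\<close> demands.\<close>

definition reflect :: "int \<Rightarrow> nat \<Rightarrow> nat" where
  "reflect m i = (if i < n then nat ((m - int i) mod int n) else i)"

lemma reflect_less: "i < n \<Longrightarrow> reflect m i < n"
  by (simp add: reflect_def nat_mod_n)

lemma eq_reflect_iff: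
  assumes "i < n" "j < n"
  shows "j = reflect m i \<longleftrightarrow> (int i + int j) mod int n = m mod int n"
proof -
  have "j = reflect m i \<longleftrightarrow> int j = (m - int i) mod int n"
    using assms(1) nat_mod_n(1)[of "m - int i"] by (auto simp: reflect_def)
  also have "\<dots> \<longleftrightarrow> int j mod int n = (m - int i) mod int n"
    using assms(2) by simp
  also have "\<dots> \<longleftrightarrow> int n dvd int j - (m - int i)"
    by (rule mod_eq_dvd_iff)
  also have "int j - (m - int i) = (int i + int j) - m"
    by simp
  also have "int n dvd (int i + int j) - m \<longleftrightarrow> (int i + int j) mod int n = m mod int n"
    by (rule mod_eq_dvd_iff[symmetric])
  finally show ?thesis .
qed

lemma reflect_permutes: "reflect m permutes {0..<n}"
proof (rule bij_imp_permutes)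
  have "reflect m (reflect m i) = i" if "i < n" for i
    using eq_reflect_iff[OF that reflect_less[OF that], of m m] that
      eq_reflect_iff[OF reflect_less[OF that] that, of m m] by (simp add: add.commute)
  then show "bij_betw (reflect m) {0..<n} {0..<n}"
    by (intro bij_betw_byWitness[where f' = "reflect m"]) (auto simp: reflect_less)
qed (simp add: reflect_def)

text \<open>An Apery family is a k[T]-basis of the integral elements, so in it multiplication by
  \<open>y\<close> has a polynomial matrix.\<close>

lemma trace_integral:
  assumes "y \<in> ring_of_integers \<iota>"
  shows "\<exists>q. ext_trace \<iota> y = to_fract q"
proof -
  obtain w where w: "apery w"
    using ex_apery by blast
  note bs = graded_basis[OF aperyD(1)[OF w]]
  have "\<exists>q. coord w (y * w i) i = to_fract q" if i: "i < n" for i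
  proof -
    have "y * w i \<in> poly_span w"
      using apery_poly_span[OF w] integral_add_mult(2)[OF assms aperyD(2)[OF w i]] by simp
    then obtain p where "y * w i = (\<Sum>j<n. \<iota> (to_fract (p j)) * w j)"
      by (auto simp: poly_span_def h_def)
    then show ?thesis
      using coord_unique[OF bs _ i, of _ "\<lambda>j. to_fract (p j)"] by blast
  qed
  then obtain q where "\<And>i. i < n \<Longrightarrow> coord w (y * w i) i = to_fract (q i)"
    by metis
  then have "ext_trace \<iota> y = to_fract (\<Sum>i<n. q i)"
    by (simp add: ext_trace_eq[OF bs])
  then show ?thesis
    by blast
qed

section \<open>Gram matrices of the trace form and the discriminant ideal\<close>

definition gram :: "(nat \<Rightarrow> 'l) \<Rightarrow> 'k poly fract mat" where
  "gram b = mat n n (\<lambda>(i, j). ext_trace \<iota> (b i * b j))"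

lemma gram_carrier [simp]: "gram b \<in> carrier_mat n n"
  by (simp add: gram_def)

lemma disc_list_gram: "length xs = n \<Longrightarrow> disc_list \<iota> xs = det (gram (nth xs))"
  by (simp add: disc_list_def gram_def)

text \<open>The trace of \<open>b i * b j\<close> attains full degree exactly when \<open>n\<close>
  divides \<open>i + j\<close>. So \<open>dg_det\<close> applies with the permutation
  \<open>reflect 0\<close> and with weights \<open>dg (b i)\<close> for rows and columns
  alike.\<close>

lemma dg_det_gram:
  assumes b: "graded b" and char: "\<not> CHAR('k) dvd n"
  shows "det (gram b) \<noteq> 0" "dg (\<iota> (det (gram b))) = 2 * (\<Sum>i<n. dg (b i))"
proof -
  define A where "A = map_mat \<iota> (gram b)"
  have A: "A \<in> carrier_mat n n"
    by (simp add: A_def)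
  have A_eq: "A $$ (i, j) = \<iota> (ext_trace \<iota> (b i * b j))" if "i < n" "j < n" for i j
    using that by (simp add: A_def gram_def)
  have bb: "b i * b j \<noteq> 0" "dg (b i * b j) = dg (b i) + dg (b j)"
    "dg (b i * b j) mod int n = 0 \<longleftrightarrow> j = reflect 0 i" if "i < n" "j < n" for i j
  proof -
    show "b i * b j \<noteq> 0" and eq: "dg (b i * b j) = dg (b i) + dg (b j)"
      using that gradedD(1)[OF b] by (auto simp: dg_mult)
    have "dg (b i * b j) mod int n = (dg (b i) mod int n + dg (b j) mod int n) mod int n"
      by (simp add: eq mod_add_eq)
    then show "dg (b i * b j) mod int n = 0 \<longleftrightarrow> j = reflect 0 i"
      using that gradedD(2)[OF b] by (simp add: eq_reflect_iff)
  qed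
  have nz: "A $$ (i, reflect 0 i) \<noteq> 0"
    and eq: "dg (A $$ (i, reflect 0 i)) = dg (b i) + dg (b (reflect 0 i))" if i: "i < n" for i
    using bb[OF i reflect_less[OF i]] dg_trace_eq[OF _ _ char, of "b i * b (reflect 0 i)"]
    by (simp_all add: A_eq i reflect_less)
  have less: "bd (dg (b i) + dg (b j) - 1) (A $$ (i, j))"
    if "i < n" "j < n" "j \<noteq> reflect 0 i" for i j
    using bb[OF that(1,2)] bd_trace_less[of "b i * b j"] that by (simp add: A_eq)
  have "det A \<noteq> 0" "dg (det A) = (\<Sum>i<n. dg (b i)) + (\<Sum>i<n. dg (b i))"
    using dg_det[OF A reflect_permutes nz eq less] by auto
  then show "det (gram b) \<noteq> 0" "dg (\<iota> (det (gram b))) = 2 * (\<Sum>i<n. dg (b i))"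
    by (simp_all add: A_def)
qed

text \<open>If \<open>A\<close> expresses \<open>x\<close> in terms of \<open>w\<close>, the Gram
  matrix becomes \<open>A * gram w * A\<^sup>T\<close>, so \<open>d\<close> is the square of a
  polynomial determinant.\<close>

lemma gram_poly_span:
  assumes "\<And>i. i < n \<Longrightarrow> x i \<in> poly_span w"
  shows "\<exists>d. det (gram x) = to_fract d * det (gram w)"
proof -
  obtain p where p: "\<And>i. i < n \<Longrightarrow> x i = (\<Sum>l<n. h (p i l) * w l)"
    using assms unfolding poly_span_def by (simp add: mem_Collect_eq) metis
  interpret tf: comm_ring_hom "to_fract :: 'k poly \<Rightarrow> 'k poly fract"
    by unfold_locales auto
  define P where "P = mat n n (\<lambda>(i, l). p i l)"
  define A where "A = map_mat to_fract P"
  have A: "A \<in> carrier_mat n n"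
    by (simp add: A_def P_def)
  have "gram x = A * gram w * A\<^sup>T"
  proof (rule eq_matI)
    fix i j assume "i < dim_row (A * gram w * A\<^sup>T)" "j < dim_col (A * gram w * A\<^sup>T)"
    then have ij: "i < n" "j < n"
      using A by auto
    have "x i * x j = (\<Sum>m<n. \<Sum>l<n. \<iota> (to_fract (p i l) * to_fract (p j m)) * (w l * w m))"
      unfolding p[OF ij(1)] p[OF ij(2)] sum_product
      by (subst sum.swap) (simp add: h_def hom_mult mult_ac)
    then have "ext_trace \<iota> (x i * x j)
        = (\<Sum>m<n. \<Sum>l<n. to_fract (p i l) * to_fract (p j m) * ext_trace \<iota> (w l * w m))"
      by (simp only: ext_trace_sum ext_trace_scale)
    then show "gram x $$ (i, j) = (A * gram w * A\<^sup>T) $$ (i, j)"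
      using ij by (simp add: gram_def A_def P_def scalar_prod_def atLeast0LessThan
          sum_distrib_right sum_distrib_left mult_ac)
  qed (use A in \<open>auto simp: gram_def\<close>)
  then have "det (gram x) = det (A * gram w) * det (A\<^sup>T)"
    using A by (simp add: det_mult[of _ n])
  also have "\<dots> = det A * det (gram w) * det A"
    using A by (simp add: det_mult[of _ n] det_transpose[OF A])
  also have "det A = to_fract (det P)"
    by (simp add: A_def)
  finally have "det (gram x) = to_fract (det P * det P) * det (gram w)"
    by (simp add: mult_ac)
  then show ?thesis
    by blast
qed

text \<open>By \<open>gram_poly_span\<close> the Gram determinant \<open>f0\<close> of an Apery
  family generates the discriminant ideal; its degree comes from \<open>dg_det_gram\<close>.\<close>

lemma disc_ideal_degree:
  assumes w: "apery w" and char: "\<not> CHAR('k) dvd n"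
  shows "int n * int (ideal_degree (disc_ideal \<iota>)) = 2 * (\<Sum>i<n. dg (w i))"
proof -
  interpret pm: Modules.module "(*) :: 'k poly \<Rightarrow> 'k poly \<Rightarrow> 'k poly"
    by unfold_locales (simp_all add: algebra_simps)
  interpret tf: comm_ring_hom "to_fract :: 'k poly \<Rightarrow> 'k poly fract"
    by unfold_locales auto
  have ww: "w i * w j \<in> ring_of_integers \<iota>" if "i < n" "j < n" for i j
    using aperyD(2)[OF w] that by (intro integral_add_mult)
  then have "\<forall>i j. \<exists>q. i < n \<longrightarrow> j < n \<longrightarrow> ext_trace \<iota> (w i * w j) = to_fract q"
    using trace_integral by blast
  then obtain T where T: "\<And>i j. i < n \<Longrightarrow> j < n \<Longrightarrow> ext_trace \<iota> (w i * w j) = to_fract (T i j)"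
    by metis
  define f0 where "f0 = det (mat n n (\<lambda>(i, j). T i j))"
  have "gram w = map_mat to_fract (mat n n (\<lambda>(i, j). T i j))"
    using T by (intro eq_matI) (auto simp: gram_def)
  then have f0: "det (gram w) = to_fract f0"
    by (simp add: f0_def)
  note dgram = dg_det_gram[OF aperyD(1)[OF w] char, unfolded f0]
  define F where "F = {f. \<exists>xs. length xs = n \<and> set xs \<subseteq> ring_of_integers \<iota> \<and> to_fract f = disc_list \<iota> xs}"
  have "gram (nth (map w [0..<n])) = gram w"
    by (intro eq_matI) (auto simp: gram_def)
  then have "to_fract f0 = disc_list \<iota> (map w [0..<n])"
    by (simp add: disc_list_gram f0)
  then have "f0 \<in> F"
    using aperyD(2)[OF w] unfolding F_def
    by (intro CollectI exI[of _ "map w [0..<n]"]) auto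
  moreover have "F \<subseteq> pm.span {f0}"
  proof
    fix f assume "f \<in> F"
    then obtain xs where xs: "length xs = n" "set xs \<subseteq> ring_of_integers \<iota>" "to_fract f = disc_list \<iota> xs"
      by (auto simp: F_def)
    then have "xs ! i \<in> poly_span w" if "i < n" for i
      using that apery_poly_span[OF w] nth_mem[of i xs] by auto
    then obtain d where "det (gram (nth xs)) = to_fract d * det (gram w)"
      using gram_poly_span by blast
    then have "to_fract f = to_fract (d * f0)"
      using xs by (simp add: disc_list_gram f0)
    then have "f = d * f0"
      by (simp only: to_fract_eq_iff)
    then show "f \<in> pm.span {f0}"
      by (auto simp: pm.span_singleton)
  qed
  ultimately have I: "disc_ideal \<iota> = pm.span {f0}"
    unfolding disc_ideal_def F_def[symmetric] by (simp add: pm.span_eq pm.span_base)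
  \<comment> \<open>\<open>ideal_degree\<close> refers to some chosen generator; it and
    \<open>f0\<close> divide each other, so their degrees agree.\<close>
  define g where "g = (SOME f. pm.span {f} = disc_ideal \<iota>)"
  have "pm.span {g} = disc_ideal \<iota>"
    unfolding g_def by (rule someI[of _ f0]) (simp add: I)
  then have g: "g \<in> pm.span {f0}" and f0g: "f0 \<in> pm.span {g}"
    using pm.span_base[of g "{g}"] pm.span_base[of f0 "{f0}"] by (simp_all add: I)
  have dvd: "f0 dvd g" "g dvd f0"
    using pm.span_singleton[of f0] g pm.span_singleton[of g] f0g by (metis dvd_triv_right imageE)+
  then have "f0 \<noteq> 0" "g \<noteq> 0"
    using dgram(1) by auto
  then have "degree g = degree f0"
    using dvd by (intro antisym dvd_imp_degree_le)
  then have "ideal_degree (disc_ideal \<iota>) = degree f0"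
    by (simp add: ideal_degree_def g_def)
  then show ?thesis
    using dgram by (simp add: dg_h flip: h_def)
qed

section \<open>Optimal approximation by integral elements\<close>

lemma ex_reduced:
  assumes w: "apery w" and x: "x \<notin> ring_of_integers \<iota>"
  shows "\<exists>y\<in>ring_of_integers \<iota>. dg (x - y) < dg (w (nat (dg (x - y) mod int n)))"
proof -
  obtain t where t: "t \<noteq> 0" "h t * x \<in> ring_of_integers \<iota>"
    using ex_integral_multiple by blast
  have nz: "x - y \<noteq> 0" if "y \<in> ring_of_integers \<iota>" for y
    using x that by auto
  \<comment> \<open>Multiplying by the denominator \<open>t\<close> makes all differences integral,
    which bounds their degrees from below, so a closest \<open>y\<close> exists.\<close>
  have lower: "dg (h t) + dg (x - y) \<ge> 0" if y: "y \<in> ring_of_integers \<iota>" for y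
  proof -
    have "h t * (x - y) \<in> ring_of_integers \<iota>"
      using integral_diff[OF t(2) integral_scale[OF y]] by (simp add: right_diff_distrib)
    then have "dg (h t * (x - y)) \<ge> 0"
      using t(1) nz[OF y] by (intro integral_dg_nonneg) auto
    then show ?thesis
      using t(1) nz[OF y] by (simp add: dg_mult)
  qed
  obtain y where y: "y \<in> ring_of_integers \<iota>"
    and least: "\<And>y'. y' \<in> ring_of_integers \<iota> \<Longrightarrow> nat (dg (h t) + dg (x - y)) \<le> nat (dg (h t) + dg (x - y'))"
    using ex_has_least_nat[of "\<lambda>y. y \<in> ring_of_integers \<iota>" 0 "\<lambda>y. nat (dg (h t) + dg (x - y))"] integral_0
    by blast
  define m where "m = dg (x - y)"
  define r where "r = nat (m mod int n)"
  \<comment> \<open>Otherwise an integral multiple of \<open>w r\<close> would share the leading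
    term of \<open>x - y\<close> and give a closer element.\<close>
  have "\<not> dg (w r) \<le> m"
  proof
    assume "dg (w r) \<le> m"
    then obtain k where z: "h (monom 1 k) * w r \<noteq> 0" "dg (h (monom 1 k) * w r) = dg (x - y)"
      using apery_monom[OF w, of m] by (auto simp: r_def m_def)
    obtain c where c: "bd (dg (x - y) - 1) (x - y - h [:c:] * (h (monom 1 k) * w r))"
      using ex_same_leading[OF nz[OF y] z(1)] z(2) by auto
    define y' where "y' = y + h [:c:] * (h (monom 1 k) * w r)"
    have y': "y' \<in> ring_of_integers \<iota>"
      unfolding y'_def r_def
      by (intro integral_add_mult(1) y integral_scale aperyD(2)[OF w] nat_mod_n(2))
    have eq: "x - y' = x - y - h [:c:] * (h (monom 1 k) * w r)"
      by (simp add: y'_def)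
    have "dg (x - y') < dg (x - y)"
      using c[folded eq] nz[OF y'] by (simp add: bd_def)
    then show False
      using least[OF y'] lower[OF y'] lower[OF y] by linarith
  qed
  then show ?thesis
    by (intro bexI[OF _ y]) (simp add: m_def r_def)
qed

text \<open>A closer \<open>y'\<close> would make \<open>y' - y\<close> an integral element of
  degree \<open>dg (x - y)\<close>, but \<open>less\<close> puts this degree below the least
  integral degree in its residue class.\<close>

lemma local_euclidean_min_reduced:
  assumes w: "apery w" and x: "x \<notin> ring_of_integers \<iota>" and y: "y \<in> ring_of_integers \<iota>"
    and less: "dg (x - y) < dg (w (nat (dg (x - y) mod int n)))"
  shows "local_euclidean_min \<iota> x = deg_infty (ext_norm \<iota> (x - y))"
    and "deg_infty (ext_norm \<iota> (x - y)) = ereal (of_int (dg (x - y)))"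
proof -
  have nz: "x - y \<noteq> 0" if "y \<in> ring_of_integers \<iota>" for y
    using x that by auto
  have deg: "deg_infty (ext_norm \<iota> (x - y)) = ereal (of_int (dg (x - y)))"
    if "y \<in> ring_of_integers \<iota>" for y
    using nz[OF that] by (simp add: deg_infty_ext_norm)
  have "dg (x - y) \<le> dg (x - y')" if y': "y' \<in> ring_of_integers \<iota>" for y'
  proof (rule ccontr)
    assume "\<not> dg (x - y) \<le> dg (x - y')"
    then have "bd (dg (x - y) - 1) (x - y')"
      by (simp add: bd_def)
    then have "bd (dg (x - y) - 1) (- (x - y'))"
      by (simp only: bd_uminus)
    moreover have "(x - y) + - (x - y') = y' - y"
      by simp
    ultimately have "y' - y \<noteq> 0" "dg (y' - y) = dg (x - y)"
      using dg_add_eq[OF nz[OF y], of "- (x - y')"] by simp_all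
    then show False
      using aperyD(3)[OF w integral_diff[OF y' y]] less by simp
  qed
  then show "local_euclidean_min \<iota> x = deg_infty (ext_norm \<iota> (x - y))"
    unfolding local_euclidean_min_def
    by (intro antisym INF_lower INF_greatest y) (simp add: deg y)
  show "deg_infty (ext_norm \<iota> (x - y)) = ereal (of_int (dg (x - y)))"
    by (rule deg[OF y])
qed

lemma local_euclidean_min_integral:
  assumes "x \<in> ring_of_integers \<iota>"
  shows "local_euclidean_min \<iota> x = - \<infinity>" "deg_infty (ext_norm \<iota> (x - x)) = local_euclidean_min \<iota> x"
proof -
  have deg: "deg_infty (ext_norm \<iota> (x - x)) = - \<infinity>"
    by (simp add: deg_infty_ext_norm)
  have "local_euclidean_min \<iota> x \<le> deg_infty (ext_norm \<iota> (x - x))"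
    unfolding local_euclidean_min_def using assms by (rule INF_lower)
  then show "local_euclidean_min \<iota> x = - \<infinity>"
    using deg by simp
  then show "deg_infty (ext_norm \<iota> (x - x)) = local_euclidean_min \<iota> x"
    using deg by simp
qed

text \<open>The Euclidean minimum is the Frobenius number of the semigroup of degrees.\<close>

lemma euclidean_min_eq:
  assumes w: "apery w" and m: "m < n" "\<And>i. i < n \<Longrightarrow> dg (w i) \<le> dg (w m)"
  shows "euclidean_min_attained \<iota>" "euclidean_min \<iota> = ereal (of_int (dg (w m) - int n))"
proof -
  have reduced: "\<exists>y\<in>ring_of_integers \<iota>. deg_infty (ext_norm \<iota> (x - y)) = local_euclidean_min \<iota> x \<and>
      deg_infty (ext_norm \<iota> (x - y)) \<le> ereal (of_int (dg (w m) - int n))" for x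
  proof (cases "x \<in> ring_of_integers \<iota>")
    case True
    then show ?thesis
      using local_euclidean_min_integral[OF True] by (intro bexI[of _ x]) auto
  next
    case False
    obtain y where y: "y \<in> ring_of_integers \<iota>" "dg (x - y) < dg (w (nat (dg (x - y) mod int n)))"
      using ex_reduced[OF w False] by blast
    define r where "r = nat (dg (x - y) mod int n)"
    note r = nat_mod_n[of "dg (x - y)", folded r_def]
    have "dg (w r) mod int n = dg (x - y) mod int n"
      using gradedD(2)[OF aperyD(1)[OF w] r(2)] r(1) by simp
    then have "int n dvd dg (w r) - dg (x - y)"
      by (simp only: mod_eq_dvd_iff)
    \<comment> \<open>Both degrees lie in one residue class modulo \<open>n\<close>, so a strict
      inequality means a difference of at least \<open>n\<close>.\<close>
    then have "int n \<le> dg (w r) - dg (x - y)"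
      using y(2) by (intro zdvd_imp_le) (simp_all add: r_def)
    then have "dg (x - y) \<le> dg (w m) - int n"
      using m(2)[OF r(2)] by linarith
    then show ?thesis
      using local_euclidean_min_reduced[OF w False y] y(1)
      by (intro bexI[of _ y]) (auto simp del: of_int_diff)
  qed
  \<comment> \<open>The extremal element: its degree is the largest in the class of \<open>m\<close>
    that no integral element has, so \<open>y = 0\<close> is already optimal for it.\<close>
  obtain x where x: "x \<noteq> 0" "dg x = dg (w m) - int n"
    using ex_dg by blast
  have "dg x mod int n = int m"
    using gradedD(2)[OF aperyD(1)[OF w] m(1)] by (simp add: x(2))
  then have less: "dg x < dg (w (nat (dg x mod int n)))"
    using x(2) n_pos by simp
  then have "x \<notin> ring_of_integers \<iota>"
    using aperyD(3)[OF w _ x(1)] by fastforce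
  then have loc: "local_euclidean_min \<iota> x = ereal (of_int (dg (w m) - int n))"
    using local_euclidean_min_reduced[OF w _ integral_0, of x] less x(2) by simp
  show eq: "euclidean_min \<iota> = ereal (of_int (dg (w m) - int n))"
    unfolding euclidean_min_def
  proof (rule antisym)
    show "(SUP x. local_euclidean_min \<iota> x) \<le> ereal (of_int (dg (w m) - int n))"
      using reduced by (intro SUP_least) metis
    show "ereal (of_int (dg (w m) - int n)) \<le> (SUP x. local_euclidean_min \<iota> x)"
      unfolding loc[symmetric] by (rule SUP_upper) simp
  qed
  show "euclidean_min_attained \<iota>"
    unfolding euclidean_min_attained_def eq
    using reduced loc by blast
qed

text \<open>Products of integral elements give \<open>dg (w m) \<le> dg (w i) + dg (w j)\<close> whenever
  \<open>i + j\<close> is congruent to \<open>m\<close> modulo \<open>n\<close>.\<close>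

lemma apery_upper:
  assumes w: "apery w" and m: "m < n"
  shows "int n * dg (w m) \<le> 2 * (\<Sum>i<n. dg (w i))"
proof -
  note g = aperyD(1)[OF w]
  have "dg (w m) \<le> dg (w i) + dg (w (reflect (int m) i))" if i: "i < n" for i
  proof -
    define j where "j = reflect (int m) i"
    have j: "j < n"
      using i by (simp add: j_def reflect_less)
    have nz: "w i * w j \<noteq> 0" and eq: "dg (w i * w j) = dg (w i) + dg (w j)"
      using gradedD(1)[OF g] i j by (auto simp: dg_mult)
    have "dg (w i * w j) mod int n = (dg (w i) mod int n + dg (w j) mod int n) mod int n"
      by (simp add: eq mod_add_eq)
    also have "\<dots> = (int i + int j) mod int n"
      using gradedD(2)[OF g] i j by simp
    also have "\<dots> = int m"
      using eq_reflect_iff[OF i j, of "int m"] m by (simp add: j_def)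
    finally have "dg (w m) \<le> dg (w i * w j)"
      using aperyD(3)[OF w integral_add_mult(2)[OF aperyD(2)[OF w i] aperyD(2)[OF w j]] nz] by simp
    then show ?thesis
      by (simp add: eq flip: j_def)
  qed
  \<comment> \<open>Summing over \<open>i\<close> counts each \<open>dg (w i)\<close> twice, since
    \<open>reflect (int m)\<close> is a permutation.\<close>
  then have "(\<Sum>i<n. dg (w m)) \<le> (\<Sum>i<n. dg (w i) + dg (w (reflect (int m) i)))"
    by (intro sum_mono) simp
  also have "\<dots> = 2 * (\<Sum>i<n. dg (w i))"
    using sum.permute[OF reflect_permutes, of "\<lambda>i. dg (w i)" "int m"]
    by (simp add: sum.distrib comp_def atLeast0LessThan)
  finally show ?thesis
    by simp
qed

text \<open>The degrees \<open>dg (w i)\<close> are pairwise distinct.\<close>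

lemma apery_lower:
  assumes w: "apery w" and m: "m < n" "\<And>i. i < n \<Longrightarrow> dg (w i) \<le> dg (w m)"
  shows "2 * (\<Sum>i<n. dg (w i)) \<le> int n * (2 * dg (w m) - int n + 1)"
proof -
  \<comment> \<open>The distances to the maximum are \<open>n\<close> distinct natural numbers, so
    their sum is at least \<open>0 + 1 + ... + (n - 1)\<close>.\<close>
  define e where "e = (\<lambda>i. nat (dg (w m) - dg (w i)))"
  have inj: "inj_on e {..<n}"
  proof (rule inj_onI)
    fix i j assume ij: "i \<in> {..<n}" "j \<in> {..<n}" "e i = e j"
    then have "dg (w i) = dg (w j)"
      using m(2)[of i] m(2)[of j] by (simp add: e_def nat_eq_iff)
    then have "int i = int j"
      using ij gradedD(2)[OF aperyD(1)[OF w]] by (metis lessThan_iff)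
    then show "i = j"
      by simp
  qed
  have "\<Sum> {0..<n} \<le> sum e {..<n}"
    using card_sum_le_nat_sum[of "e ` {..<n}"] inj by (simp add: card_image sum.reindex)
  then have "int (2 * \<Sum> {0..<n}) \<le> 2 * int (sum e {..<n})"
    by linarith
  moreover have "int (2 * \<Sum> {0..<n}) = int n * (int n - 1)"
    using n_pos gauss_sum_nat[of "n - 1"] by (cases n) (auto simp: atLeastLessThanSuc_atLeastAtMost algebra_simps)
  moreover have "int (sum e {..<n}) = (\<Sum>i<n. dg (w m) - dg (w i))"
    using m(2) by (simp add: e_def)
  ultimately show ?thesis
    by (simp add: sum_subtractf algebra_simps)
qed

end

theorem theorem9:
  fixes \<iota> :: "'k::alg_closed_field poly fract \<Rightarrow> 'l::field"
    and n :: nat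
  assumes "field_hom \<iota>"
    and "finite_ext \<iota>"
    and "separable_ext \<iota>"
    and "ext_degree \<iota> = n"
    and "totally_ramified_infinity \<iota>"
    and "\<not> CHAR('k) dvd n"
  shows "euclidean_min_attained \<iota> \<and>
    ereal ((real (ideal_degree (disc_ideal \<iota>)) - real n - 1) / 2) \<le> euclidean_min \<iota> \<and>
    euclidean_min \<iota> \<le> ereal (real (ideal_degree (disc_ideal \<iota>)) - real n)"
proof -
  obtain v where v: "above_infinity \<iota> v (ext_degree \<iota>)"
    using assms(5) by (auto simp: totally_ramified_infinity_def)
  interpret field_hom \<iota>
    by fact
  interpret totally_ramified \<iota> v
    by unfold_locales fact+
  obtain w where w: "apery w"
    using ex_apery by blast
  obtain m where m: "m < n" "\<And>i. i < n \<Longrightarrow> dg (w i) \<le> dg (w m)"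
    using Max_in[of "(\<lambda>i. dg (w i)) ` {..<n}"] Max_ge[of "(\<lambda>i. dg (w i)) ` {..<n}"] n_pos assms(4)
    by fastforce
  define d where "d = int (ideal_degree (disc_ideal \<iota>))"
  note m' = m[folded assms(4)]
  have d: "int n * d = 2 * (\<Sum>i<n. dg (w i))"
    using disc_ideal_degree[OF w] assms(4,6) by (simp add: d_def)
  have "int n * dg (w m) \<le> int n * d"
    unfolding d using apery_upper[OF w m'(1)] assms(4) by simp
  then have upper: "dg (w m) \<le> d"
    using m(1) by (simp add: mult_le_cancel_left)
  have "int n * d \<le> int n * (2 * dg (w m) - int n + 1)"
    unfolding d using apery_lower[OF w m'] assms(4) by simp
  then have lower: "d \<le> 2 * dg (w m) - int n + 1"
    using m(1) by (simp add: mult_le_cancel_left)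
  \<comment> \<open>The minimum is \<open>dg (w m) - n\<close>. Here \<open>dg (w m) \<le> d\<close>
    gives the upper bound, and \<open>dg (w m) \<ge> (d + n - 1) / 2\<close> gives
    \<open>(d - n - 1) / 2\<close> from below.\<close>
  have "real (ideal_degree (disc_ideal \<iota>)) = real_of_int d"
    by (simp add: d_def)
  moreover have "real_of_int (dg (w m)) \<le> real_of_int d"
    using upper by simp
  moreover have "real_of_int d \<le> 2 * real_of_int (dg (w m)) - real n + 1"
    using lower by linarith
  ultimately show ?thesis
    using euclidean_min_eq[OF w m'] assms(4) by simp
qed

end
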